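(* Let $D\subset\mathbb{R}^d$ be a Lipschitz domain, $a\in\mathcal{A}$, and $f\in L_2(D)$ with $f\ge c_f>0$. Then the triplet $(D,a,f)$ satisfies the positivity condition $\mathbf{PC}(2)$ with a constant depending only on $\lambda,\Lambda,d,D,c_f$; that is, there is a constant $c>0$ depending only on $\lambda,\Lambda,d,D,c_f$ such that $$a(x)|\nabla u_a(x)|^2+f(x)u_a(x)\ge c\,\mathrm{dist}(x,\partial D)^2\quad\text{for a.e. }x\in D.$$
   Context: $D\subset\mathbb{R}^d$, $d\ge 2$, is a bounded domain (open, connected). $\lambda,\Lambda$ are fixed positive constants and $\mathcal{A}:=\{a\in L_\infty(D):\lambda\le a\le\Lambda\}$. For $a\in\mathcal{A}$, $u_a\in H^1_0(D)$ is the unique weak solution of $-\mathrm{div}(a\nabla u_a)=f$ on $D$, $u_a=0$ on $\partial D$, i.e. $\int_D a\nabla u_a\cdot\nabla v=\int_D fv$ for all $v\in H^1_0(D)$. *)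

theory Defs
  imports "HOL-Analysis.Analysis"
begin

text \<open>A bounded domain whose boundary is, near each of its points, the graph of a Lipschitz function
  over a hyperplane, with the domain lying strictly on one side of it. The hyperplane is the
  orthogonal complement of a unit vector \<open>e\<close>, so that no rotation of coordinates is needed.\<close>

definition lipschitz_domain :: "'a::euclidean_space set \<Rightarrow> bool" where
  "lipschitz_domain D \<longleftrightarrow>
     bounded D \<and> open D \<and> connected D \<and>
     (\<forall>z\<in>frontier D. \<exists>e r L \<gamma>.
        norm e = 1 \<and> 0 < r \<and> L-lipschitz_on {y. y \<bullet> e = 0} \<gamma> \<and>
        D \<inter> ball z r = {x \<in> ball z r. \<gamma> (x - (x \<bullet> e) *\<^sub>R e) < x \<bullet> e})"

primrec C_k :: "nat \<Rightarrow> ('a::euclidean_space \<Rightarrow> real) \<Rightarrow> bool" where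
  "C_k 0 \<phi> \<longleftrightarrow> continuous_on UNIV \<phi>"
| "C_k (Suc k) \<phi> \<longleftrightarrow>
     (\<forall>x. \<phi> differentiable (at x)) \<and> (\<forall>v. C_k k (\<lambda>x. frechet_derivative \<phi> (at x) v))"

definition grad :: "('a::euclidean_space \<Rightarrow> real) \<Rightarrow> 'a \<Rightarrow> 'a" where
  "grad \<phi> x = (\<Sum>b\<in>Basis. frechet_derivative \<phi> (at x) b *\<^sub>R b)"

text \<open>The space of smooth functions with compact support in \<open>D\<close>.\<close>

definition test_functions :: "'a::euclidean_space set \<Rightarrow> ('a \<Rightarrow> real) set" where
  "test_functions D =
     {\<phi>. (\<forall>k. C_k k \<phi>) \<and> compact (closure {x. \<phi> x \<noteq> 0}) \<and> closure {x. \<phi> x \<noteq> 0} \<subseteq> D}"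

text \<open>Elements of Lebesgue and Sobolev spaces are represented by functions on the whole space, of
  which only the values almost everywhere on \<open>D\<close> matter. Since a weak gradient is determined only
  up to null sets, it is treated as a relation between representatives.\<close>

definition L2 :: "'a::euclidean_space set \<Rightarrow> ('a \<Rightarrow> 'b::euclidean_space) set" where
  "L2 D = {f. f \<in> borel_measurable (lebesgue_on D) \<and>
              integrable (lebesgue_on D) (\<lambda>x. (norm (f x))\<^sup>2)}"

definition locally_integrable ::
    "'a::euclidean_space set \<Rightarrow> ('a \<Rightarrow> 'b::euclidean_space) \<Rightarrow> bool" where
  "locally_integrable D f \<longleftrightarrow> (\<forall>K. compact K \<and> K \<subseteq> D \<longrightarrow> integrable (lebesgue_on K) f)"

definition weak_gradient ::
    "'a::euclidean_space set \<Rightarrow> ('a \<Rightarrow> real) \<Rightarrow> ('a \<Rightarrow> 'a) \<Rightarrow> bool" where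
  "weak_gradient D u g \<longleftrightarrow>
     locally_integrable D u \<and> locally_integrable D g \<and>
     (\<forall>\<phi>\<in>test_functions D.
        (LINT x|lebesgue_on D. u x *\<^sub>R grad \<phi> x) = - (LINT x|lebesgue_on D. \<phi> x *\<^sub>R g x))"

text \<open>The closure of the test functions in the Sobolev space of functions that are square integrable
  together with their weak gradient; the sum of integrals is the squared norm of \<open>u - \<phi> n\<close> there.\<close>

definition H10 :: "'a::euclidean_space set \<Rightarrow> ('a \<Rightarrow> real) set" where
  "H10 D = {u. u \<in> L2 D \<and>
     (\<exists>g \<phi>. g \<in> L2 D \<and> weak_gradient D u g \<and> (\<forall>n::nat. \<phi> n \<in> test_functions D) \<and>
        (\<lambda>n. (LINT x|lebesgue_on D. (u x - \<phi> n x)\<^sup>2) +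
             (LINT x|lebesgue_on D. (norm (g x - grad (\<phi> n) x))\<^sup>2)) \<longlonglongrightarrow> 0)}"

definition admissible_coeffs :: "'a::euclidean_space set \<Rightarrow> real \<Rightarrow> real \<Rightarrow> ('a \<Rightarrow> real) set" where
  "admissible_coeffs D lam Lam =
     {a. a \<in> borel_measurable (lebesgue_on D) \<and> (AE x in lebesgue_on D. lam \<le> a x \<and> a x \<le> Lam)}"

definition weak_solution ::
    "'a::euclidean_space set \<Rightarrow> ('a \<Rightarrow> real) \<Rightarrow> ('a \<Rightarrow> real) \<Rightarrow> ('a \<Rightarrow> real) \<Rightarrow> bool" where
  "weak_solution D a f u \<longleftrightarrow> u \<in> H10 D \<and>
     (\<forall>g v h. weak_gradient D u g \<and> v \<in> H10 D \<and> weak_gradient D v h \<longrightarrow>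
        (LINT x|lebesgue_on D. a x * (g x \<bullet> h x)) = (LINT x|lebesgue_on D. f x * v x))"

text \<open>The positivity condition of order \<open>\<beta>\<close> with constant \<open>c\<close>. The weak solution and its weak gradient
  are unique up to null sets; the condition is imposed on all of their representatives.\<close>

definition positivity_condition ::
    "'a::euclidean_space set \<Rightarrow> ('a \<Rightarrow> real) \<Rightarrow> ('a \<Rightarrow> real) \<Rightarrow> real \<Rightarrow> real \<Rightarrow> bool" where
  "positivity_condition D a f \<beta> c \<longleftrightarrow>
     (\<forall>u g. weak_solution D a f u \<and> weak_gradient D u g \<longrightarrow>
        (AE x in lebesgue_on D.
           a x * (norm (g x))\<^sup>2 + f x * u x \<ge> c * infdist x (frontier D) powr \<beta>))"

end

theory Submission
  imports Defs
begin

text \<open>Since \<open>a |\<nabla>u|\<^sup>2 \<ge> 0\<close>, it suffices to bound \<open>u\<close> from below: if a ball of radius \<open>R\<close> lies in \<open>D\<close>, then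
  \<open>u \<ge> \<kappa> R\<^sup>2\<close> on the concentric ball of radius \<open>R/2\<close>. This is a De Giorgi type argument at the single
  level \<open>k = \<kappa> R\<^sup>2\<close>. First, \<open>u \<ge> 0\<close> by the maximum principle, so \<open>W = (k - u)\<^sup>+\<close> satisfies \<open>0 \<le> W \<le> k\<close>.
  Testing the equation with \<open>\<eta>\<^sup>2 W\<close> for a cutoff \<open>\<eta>\<close> bounds both \<open>\<integral>\<eta>\<^sup>2 |\<nabla>W|\<^sup>2\<close> and, because \<open>f \<ge> c_f\<close>, also
  \<open>\<integral>\<eta>\<^sup>2 W\<close> by a multiple of \<open>\<integral>W\<^sup>2 |\<nabla>\<eta>|\<^sup>2\<close>. Nash's inequality, with a free radius \<open>\<rho>\<close>, combines the two into
  \<open>X\<^sub>j\<^sub>+\<^sub>1 \<le> X\<^sub>j / (2\<beta>) + C \<beta>\<^sup>j X\<^sub>j\<^sup>2\<close> for the integrals \<open>X\<^sub>j\<close> of \<open>W\<^sup>2\<close> over balls with radii decreasing from \<open>R\<close>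
  to \<open>R/2\<close>. For small \<open>\<kappa>\<close> this forces \<open>X\<^sub>j \<rightarrow> 0\<close>, that is \<open>W = 0\<close> on the smaller ball.\<close>

section \<open>Smooth functions\<close>

text \<open>The nonlinearity comes from the source term: it bounds the integral of W, which is
  linear in W, by the cutoff error E, which is quadratic in W. The squared integral in Nash's
  inequality is therefore of order E^2, and the recursion is superlinear at one fixed level. The
  gradient term stays linear in E; taking \<rho> proportional to the gap between consecutive radii
  makes its coefficient a constant as small as desired. The bound W \<le> k gives X_0 \<le> k^2
  |B_R|. With k = \<kappa> R^2 all powers of R cancel in the smallness condition, so one \<kappa>
  serves every ball in D, and balls of radius comparable to the distance from the boundary turn R^2
  into the squared distance. Nash's inequality has the same form in every dimension, while the
  Sobolev exponent would single out d = 2.\<close>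

lemma C_k_SucI:
  assumes "\<And>x. (\<phi> has_derivative \<phi>' x) (at x)" "\<And>v. C_k k (\<lambda>x. \<phi>' x v)"
  shows "C_k (Suc k) \<phi>"
proof -
  have "frechet_derivative \<phi> (at x) = \<phi>' x" for x
    using assms(1) by (metis frechet_derivative_at)
  then show ?thesis
    using assms by (auto simp: differentiable_def)
qed

lemma C_k_SucD:
  assumes "C_k (Suc k) \<phi>"
  shows "(\<phi> has_derivative frechet_derivative \<phi> (at x)) (at x)"
    and "C_k k (\<lambda>x. frechet_derivative \<phi> (at x) v)"
  using assms frechet_derivative_works by auto

lemma C_k_Suc_imp: "C_k (Suc k) \<phi> \<Longrightarrow> C_k k \<phi>"
proof (induction k arbitrary: \<phi>)
  case 0
  then show ?case
    by (auto intro!: continuous_at_imp_continuous_on differentiable_imp_continuous_within)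
next
  case (Suc k)
  then show ?case by (metis C_k.simps(2))
qed

lemma C_k_const [simp]: "C_k k (\<lambda>x. c)"
proof (induction k arbitrary: c)
  case (Suc k)
  show ?case by (rule C_k_SucI[where \<phi>' = "\<lambda>x v. 0"]) (use Suc in auto)
qed auto

lemma C_k_inner [simp]: "C_k k (\<lambda>x. x \<bullet> b)"
proof (cases k)
  case (Suc l)
  have "C_k (Suc l) (\<lambda>x. x \<bullet> b)"
    by (rule C_k_SucI[where \<phi>' = "\<lambda>x v. v \<bullet> b"]) (auto intro!: derivative_eq_intros)
  then show ?thesis using Suc by simp
qed (auto intro!: continuous_intros)

lemma C_k_add: "C_k k \<phi> \<Longrightarrow> C_k k \<psi> \<Longrightarrow> C_k k (\<lambda>x. \<phi> x + \<psi> x)"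
proof (induction k arbitrary: \<phi> \<psi>)
  case (Suc k)
  show ?case
    by (intro C_k_SucI[OF has_derivative_add[OF C_k_SucD(1)[OF Suc.prems(1)] C_k_SucD(1)[OF Suc.prems(2)]]]
        Suc.IH C_k_SucD(2)[OF Suc.prems(1)] C_k_SucD(2)[OF Suc.prems(2)])
qed (auto intro!: continuous_intros)

lemma C_k_mult: "C_k k \<phi> \<Longrightarrow> C_k k \<psi> \<Longrightarrow> C_k k (\<lambda>x. \<phi> x * \<psi> x)"
proof (induction k arbitrary: \<phi> \<psi>)
  case (Suc k)
  note C_k_Suc_imp[OF Suc.prems(1)] C_k_Suc_imp[OF Suc.prems(2)]
  then show ?case
    by (intro C_k_SucI[OF has_derivative_mult[OF C_k_SucD(1)[OF Suc.prems(1)] C_k_SucD(1)[OF Suc.prems(2)]]]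
        C_k_add Suc.IH C_k_SucD(2)[OF Suc.prems(1)] C_k_SucD(2)[OF Suc.prems(2)])
qed (auto intro!: continuous_intros)

lemma C_k_diff: "C_k k \<phi> \<Longrightarrow> C_k k \<psi> \<Longrightarrow> C_k k (\<lambda>x. \<phi> x - \<psi> x)"
  using C_k_add[of k \<phi> "\<lambda>x. -1 * \<psi> x"] C_k_mult[OF C_k_const[of k "-1"], of \<psi>] by simp

lemma C_k_sum: "(\<And>i. i \<in> I \<Longrightarrow> C_k k (\<phi> i)) \<Longrightarrow> C_k k (\<lambda>x. \<Sum>i\<in>I. \<phi> i x)"
  by (induction I rule: infinite_finite_induct) (simp_all add: C_k_add)

lemma C_k_norm_diff_sq: "C_k k (\<lambda>x. (norm (x - z))\<^sup>2)"
proof -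
  have "(\<lambda>x. (norm (x - z))\<^sup>2) = (\<lambda>x. \<Sum>b\<in>Basis. (x \<bullet> b - z \<bullet> b) * (x \<bullet> b - z \<bullet> b))"
    unfolding power2_norm_eq_inner by (subst euclidean_inner) (simp add: inner_diff_left)
  then show ?thesis by (simp add: C_k_sum C_k_mult C_k_diff)
qed

text \<open>A function \<open>G 0\<close> of one variable bundled with all its derivatives. In the
  induction for \<open>C_k_compose\<close> the chain rule replaces \<open>G n\<close> by
  \<open>G (Suc n)\<close>, so the claim has to be made for all members of the sequence at
  once.\<close>

definition derivative_sequence :: "(nat \<Rightarrow> real \<Rightarrow> real) \<Rightarrow> bool" where
  "derivative_sequence G \<longleftrightarrow> (\<forall>n t. (G n has_real_derivative G (Suc n) t) (at t))"

lemma C_k_compose: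
  assumes "derivative_sequence G" "C_k k \<phi>"
  shows "C_k k (\<lambda>x. G n (\<phi> x))"
  using assms(2)
proof (induction k arbitrary: \<phi> n)
  case 0
  have "continuous_on UNIV (G n)"
    using assms(1) by (auto simp: derivative_sequence_def intro!: continuous_at_imp_continuous_on DERIV_isCont)
  then show ?case
    using 0 continuous_on_compose2[of UNIV "G n" UNIV \<phi>] by simp
next
  case (Suc k)
  have "((\<lambda>x. G n (\<phi> x)) has_derivative (\<lambda>v. frechet_derivative \<phi> (at x) v * G (Suc n) (\<phi> x))) (at x)" for x
    using assms(1) C_k_SucD(1)[OF Suc.prems]
    by (intro DERIV_compose_FDERIV[where f = "G n"]) (auto simp: derivative_sequence_def)
  then show ?case
    by (rule C_k_SucI) (intro C_k_mult Suc.IH C_k_SucD(2)[OF Suc.prems] C_k_Suc_imp[OF Suc.prems])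
qed

section \<open>The bump exp(-1/t) and its derivatives\<close>

definition exp_inverse :: "real poly \<Rightarrow> real \<Rightarrow> real" where
  "exp_inverse p t = (if t > 0 then poly p (1 / t) * exp (- (1 / t)) else 0)"

lemma poly_times_exp_tendsto_0: "((\<lambda>y::real. poly p y * exp (- y)) \<longlongrightarrow> 0) at_top"
proof -
  have "((\<lambda>y. \<Sum>i\<le>degree p. coeff p i * (y ^ i / exp y)) \<longlongrightarrow> (\<Sum>i\<le>degree p. coeff p i * 0)) at_top"
    by (intro tendsto_intros tendsto_power_div_exp_0)
  moreover have "(\<lambda>y. \<Sum>i\<le>degree p. coeff p i * (y ^ i / exp y)) = (\<lambda>y. poly p y * exp (- y))"
    by (auto simp: poly_altdef sum_distrib_right exp_minus divide_simps intro!: sum.cong)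
  ultimately show ?thesis by simp
qed

text \<open>With s = 1/t, d/dt is -s^2 d/ds, which turns p(s) exp(-s) into s^2 (p - p')(s) exp(-s);
  so the family is closed under differentiation. At 0 the right difference quotient is s p(s)
  exp(-s), which tends to 0 as s grows.\<close>

lemma exp_inverse_has_derivative:
  "(exp_inverse p has_real_derivative exp_inverse ((p - pderiv p) * monom 1 2) t) (at t)"
proof -
  consider "t > 0" | "t < 0" | "t = 0" by linarith
  then show ?thesis
  proof cases
    case 1
    have "((\<lambda>t. poly p (1 / t) * exp (- (1 / t))) has_real_derivative
        exp_inverse ((p - pderiv p) * monom 1 2) t) (at t)"
      using 1 by (auto simp: exp_inverse_def poly_monom power2_eq_square field_simps
          intro!: derivative_eq_intros)
    then show ?thesis
      using eventually_nhds_in_open[of "{0<..}" t] 1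
      by (subst DERIV_cong_ev[OF refl _ refl, of _ "\<lambda>t. poly p (1 / t) * exp (- (1 / t))"])
        (auto simp: exp_inverse_def elim!: eventually_mono)
  next
    case 2
    then show ?thesis
      using eventually_nhds_in_open[of "{..<0}" t]
      by (subst DERIV_cong_ev[OF refl _ refl, of _ "\<lambda>t. 0"])
        (auto simp: exp_inverse_def elim!: eventually_mono)
  next
    case 3
    have "((\<lambda>t. poly (monom 1 1 * p) (1 / t) * exp (- (1 / t))) \<longlongrightarrow> 0) (at_right (0::real))"
      using filterlim_compose[OF poly_times_exp_tendsto_0 filterlim_inverse_at_top_right, of "monom 1 1 * p"]
      by (simp add: inverse_eq_divide)
    then have "((\<lambda>t. exp_inverse p t / t) \<longlongrightarrow> 0) (at_right 0)"
      by (rule Lim_transform_eventually)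
        (auto simp: exp_inverse_def poly_monom eventually_at_right_less eventually_at_filter)
    moreover have "((\<lambda>t. exp_inverse p t / t) \<longlongrightarrow> 0) (at_left 0)"
      by (rule Lim_transform_eventually[of "\<lambda>_. 0"])
        (auto simp: exp_inverse_def eventually_at_filter)
    ultimately show ?thesis
      unfolding has_field_derivative_iff 3
      by (auto simp: exp_inverse_def filterlim_split_at)
  qed
qed

definition bump :: "real \<Rightarrow> real" where
  "bump t = (if t > 0 then exp (- (1 / t)) else 0)"

definition bump_deriv :: "real \<Rightarrow> real" where
  "bump_deriv t = (if t > 0 then exp (- (1 / t)) / t\<^sup>2 else 0)"

lemma bump_derivative_sequence:
  obtains G where "derivative_sequence G" "G 0 = bump" "G 1 = bump_deriv"
proof
  define p where "p = rec_nat (1 :: real poly) (\<lambda>_ p. (p - pderiv p) * monom 1 2)"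
  show "derivative_sequence (\<lambda>n. exp_inverse (p n))"
    unfolding derivative_sequence_def p_def using exp_inverse_has_derivative by simp
  show "exp_inverse (p 0) = bump"
    by (auto simp: p_def exp_inverse_def bump_def)
  show "exp_inverse (p 1) = bump_deriv"
    by (auto simp: p_def exp_inverse_def bump_deriv_def poly_monom field_simps)
qed

lemma bump_has_derivative: "(bump has_real_derivative bump_deriv t) (at t)"
proof -
  obtain G where "derivative_sequence G" and G: "G 0 = bump" "G 1 = bump_deriv"
    by (rule bump_derivative_sequence)
  then have "(G 0 has_real_derivative G 1 t) (at t)"
    unfolding derivative_sequence_def by (metis One_nat_def)
  then show ?thesis unfolding G .
qed

lemma bump_nonneg: "0 \<le> bump t" and bump_le_1: "bump t \<le> 1"
  by (auto simp: bump_def)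

lemma bump_ge: "1 \<le> t \<Longrightarrow> exp (-1) \<le> bump t"
  by (auto simp: bump_def)

text \<open>In terms of y = 1/t this is y^2 \<le> exp y, the square of y \<le> exp (y/2). The
  constant 1 is what makes the gradient bound in \<open>bump_cutoff\<close> explicit.\<close>

lemma bump_deriv_bound: "\<bar>bump_deriv t\<bar> \<le> 1"
proof (cases "t > 0")
  case True
  define y where "y = 1 / t"
  have y: "y > 0" using True by (simp add: y_def)
  have "(y / 2)\<^sup>2 * 4 \<le> exp y"
  proof -
    have "0 \<le> (y / 2 - 1)\<^sup>2" by simp
    then have "2 * (y / 2) \<le> exp (y / 2)"
      using exp_lower_Taylor_quadratic[of "y / 2"] y by (simp add: power2_eq_square algebra_simps)
    then have "(2 * (y/2))^2 \<le> (exp (y/2))^2" using y by (intro power_mono) auto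
    then show ?thesis by (simp add: power2_eq_square flip: exp_add)
  qed
  then have "y\<^sup>2 * exp (- y) \<le> 1" by (simp add: exp_minus power_divide field_simps)
  then show ?thesis using True by (simp add: bump_deriv_def y_def power_divide)
qed (simp add: bump_deriv_def)

section \<open>A smooth approximation of the positive part\<close>

definition sigmoid :: "real \<Rightarrow> real" where
  "sigmoid t = exp t / (1 + exp t)"

definition softplus :: "real \<Rightarrow> real" where
  "softplus t = ln (1 + exp t)"

lemma sigmoid_bounds: "0 \<le> sigmoid t" "sigmoid t \<le> 1"
  by (auto simp: sigmoid_def field_simps add_pos_pos)

lemma softplus_has_derivative: "(softplus has_real_derivative sigmoid t) (at t)"
proof -
  have "1 + exp t > 0" by (simp add: add_pos_pos)
  then show ?thesis
    unfolding softplus_def[abs_def] sigmoid_def by (auto intro!: derivative_eq_intros simp: field_simps)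
qed

lemma sigmoid_has_derivative: "(sigmoid has_real_derivative sigmoid t * (1 - sigmoid t)) (at t)"
proof -
  have "1 + exp t \<noteq> 0" using exp_gt_zero[of t] by linarith
  then show ?thesis
    unfolding sigmoid_def[abs_def] by (auto intro!: derivative_eq_intros simp: field_simps)
qed

text \<open>As s = \<open>sigmoid\<close> satisfies s' = s - s^2, all derivatives of
  \<open>softplus\<close> from the first on are polynomials in \<open>sigmoid\<close>; the factor
  \<open>[:0, 1, -1:]\<close> is X - X^2. The index is shifted by one because
  \<open>softplus\<close> itself is not such a polynomial.\<close>

lemma softplus_derivative_sequence:
  obtains G where "derivative_sequence G" "G 0 = softplus"
proof
  define p where "p = rec_nat [:0, 1 :: real:] (\<lambda>_ p. pderiv p * [:0, 1, -1:])"
  define G where "G = (\<lambda>n. case n of 0 \<Rightarrow> softplus | Suc n \<Rightarrow> (\<lambda>t. poly (p n) (sigmoid t)))"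
  have "((\<lambda>t. poly (p n) (sigmoid t)) has_real_derivative poly (p (Suc n)) (sigmoid t)) (at t)" for n t
    by (rule DERIV_cong[OF DERIV_chain2[OF poly_DERIV sigmoid_has_derivative]])
      (simp add: p_def algebra_simps)
  then show "derivative_sequence G"
    using softplus_has_derivative
    by (auto simp: derivative_sequence_def G_def p_def split: nat.splits)
  show "G 0 = softplus" by (simp add: G_def)
qed

lemma softplus_bounds: "max t 0 \<le> softplus t" "softplus t \<le> max t 0 + ln 2"
proof -
  have "exp t \<le> 1 + exp t" "1 \<le> 1 + exp t" by auto
  then have "ln (exp t) \<le> softplus t" "ln 1 \<le> softplus t"
    unfolding softplus_def by (intro ln_mono; simp add: add_pos_pos)+
  then show "max t 0 \<le> softplus t" by simp
  have "1 + exp t \<le> exp (max t 0) * 2" by (cases "t \<ge> 0") (auto simp: max_def)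
  then have "softplus t \<le> ln (exp (max t 0) * 2)"
    unfolding softplus_def by (intro ln_mono) (auto simp: add_pos_pos)
  then show "softplus t \<le> max t 0 + ln 2" by (simp add: ln_mult)
qed

section \<open>Test functions and Nash's inequality\<close>

definition smooth :: "('a::euclidean_space \<Rightarrow> real) \<Rightarrow> bool" where
  "smooth \<phi> \<longleftrightarrow> (\<forall>k. C_k k \<phi>)"

lemma smooth_const [simp]: "smooth (\<lambda>x. c)"
  and smooth_diff: "smooth \<phi> \<Longrightarrow> smooth \<psi> \<Longrightarrow> smooth (\<lambda>x. \<phi> x - \<psi> x)"
  and smooth_mult: "smooth \<phi> \<Longrightarrow> smooth \<psi> \<Longrightarrow> smooth (\<lambda>x. \<phi> x * \<psi> x)"
  and smooth_norm_diff_sq: "smooth (\<lambda>x. (norm (x - z))\<^sup>2)"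
  and smooth_compose: "derivative_sequence G \<Longrightarrow> smooth \<phi> \<Longrightarrow> smooth (\<lambda>x. G n (\<phi> x))"
  unfolding smooth_def
  by (simp_all add: C_k_add C_k_diff C_k_mult C_k_norm_diff_sq C_k_compose)

lemma grad_eqI:
  assumes "(\<phi> has_derivative (\<lambda>v. c \<bullet> v)) (at x)"
  shows "grad \<phi> x = c"
proof -
  have "frechet_derivative \<phi> (at x) = (\<lambda>v. c \<bullet> v)"
    using frechet_derivative_at[OF assms] by simp
  then show ?thesis by (simp add: grad_def euclidean_representation)
qed

lemma smooth_has_derivative:
  assumes "smooth \<phi>"
  shows "(\<phi> has_derivative (\<lambda>v. grad \<phi> x \<bullet> v)) (at x)"
proof -
  have d: "(\<phi> has_derivative frechet_derivative \<phi> (at x)) (at x)"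
    using assms by (auto simp: smooth_def intro: C_k_SucD(1))
  then interpret linear "frechet_derivative \<phi> (at x)"
    by (rule has_derivative_linear)
  have "frechet_derivative \<phi> (at x) v = grad \<phi> x \<bullet> v" for v
  proof -
    have "frechet_derivative \<phi> (at x) v = frechet_derivative \<phi> (at x) (\<Sum>b\<in>Basis. (v \<bullet> b) *\<^sub>R b)"
      by (simp add: euclidean_representation)
    also have "\<dots> = (\<Sum>b\<in>Basis. (v \<bullet> b) * frechet_derivative \<phi> (at x) b)"
      by (simp add: sum scale)
    also have "\<dots> = grad \<phi> x \<bullet> v"
      unfolding grad_def by (simp add: inner_sum_left inner_commute[of v] mult.commute)
    finally show ?thesis .
  qed
  then have "frechet_derivative \<phi> (at x) = (\<lambda>v. grad \<phi> x \<bullet> v)" by (rule ext)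
  then show ?thesis using d by simp
qed

lemma smooth_continuous_on: "smooth \<phi> \<Longrightarrow> continuous_on S \<phi>"
  by (rule continuous_at_imp_continuous_on, rule ballI, rule has_derivative_continuous, erule smooth_has_derivative)

lemma smooth_continuous_on_grad:
  assumes "smooth \<phi>"
  shows "continuous_on S (grad \<phi>)"
proof -
  have "C_k (Suc 0) \<phi>" using assms by (simp add: smooth_def del: C_k.simps)
  then have "C_k 0 (\<lambda>x. frechet_derivative \<phi> (at x) b)" for b by (rule C_k_SucD(2))
  then have "continuous_on UNIV (\<lambda>x. frechet_derivative \<phi> (at x) b)" for b by simp
  then have "continuous_on UNIV (grad \<phi>)"
    unfolding grad_def[abs_def] by (intro continuous_intros)
  then show ?thesis by (rule continuous_on_subset) simp
qed

lemma grad_mult: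
  assumes "smooth \<phi>" "smooth \<psi>"
  shows "grad (\<lambda>x. \<phi> x * \<psi> x) x = \<phi> x *\<^sub>R grad \<psi> x + \<psi> x *\<^sub>R grad \<phi> x"
  by (rule grad_eqI, rule has_derivative_eq_rhs[OF has_derivative_mult[OF
        smooth_has_derivative[OF assms(1)] smooth_has_derivative[OF assms(2)]]])
    (auto simp: inner_add_left)

lemma grad_compose:
  assumes "(G has_real_derivative d) (at (\<phi> x))" "smooth \<phi>"
  shows "grad (\<lambda>x. G (\<phi> x)) x = d *\<^sub>R grad \<phi> x"
  by (rule grad_eqI, rule has_derivative_eq_rhs[OF DERIV_compose_FDERIV[OF assms(1)
        smooth_has_derivative[OF assms(2)]]]) auto

lemma grad_const [simp]: "grad (\<lambda>x. c) x = 0"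
  by (rule grad_eqI) simp

lemma grad_outside_support:
  assumes "x \<notin> closure {x. \<phi> x \<noteq> 0}"
  shows "grad \<phi> x = 0"
proof (rule grad_eqI)
  have "((\<lambda>x. 0) has_derivative (\<lambda>v. 0 \<bullet> v)) (at x)" by simp
  then show "(\<phi> has_derivative (\<lambda>v. 0 \<bullet> v)) (at x)"
    by (rule has_derivative_transform_within_open[where s = "- closure {x. \<phi> x \<noteq> 0}"])
      (use assms closure_subset[of "{x. \<phi> x \<noteq> 0}"] in auto)
qed

lemma test_functionsE:
  assumes "\<phi> \<in> test_functions D"
  obtains K where "compact K" "K \<subseteq> D" "\<And>x. x \<notin> K \<Longrightarrow> \<phi> x = 0" "\<And>x. x \<notin> K \<Longrightarrow> grad \<phi> x = 0"
proof
  let ?K = "closure {x. \<phi> x \<noteq> 0}"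
  show "compact ?K" "?K \<subseteq> D"
    using assms by (auto simp: test_functions_def)
  show "x \<notin> ?K \<Longrightarrow> \<phi> x = 0" for x
    using closure_subset[of "{x. \<phi> x \<noteq> 0}"] by auto
  show "x \<notin> ?K \<Longrightarrow> grad \<phi> x = 0" for x
    by (rule grad_outside_support)
qed

lemma test_functionsD:
  assumes "\<phi> \<in> test_functions D"
  shows "smooth \<phi>" "continuous_on S \<phi>" "continuous_on S (grad \<phi>)"
proof -
  show "smooth \<phi>"
    using assms by (simp add: test_functions_def smooth_def)
  then show "continuous_on S \<phi>" "continuous_on S (grad \<phi>)"
    by (rule smooth_continuous_on, rule smooth_continuous_on_grad)
qed

lemma test_functionsI:
  assumes "smooth \<phi>" "compact K" "K \<subseteq> D" "\<And>x. x \<notin> K \<Longrightarrow> \<phi> x = 0"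
  shows "\<phi> \<in> test_functions D"
proof -
  have "closure {x. \<phi> x \<noteq> 0} \<subseteq> K"
    using assms by (intro closure_minimal compact_imp_closed) auto
  moreover have "compact (closure {x. \<phi> x \<noteq> 0})"
    unfolding compact_closure using assms
    by (intro bounded_subset[OF compact_imp_bounded[OF assms(2)]]) auto
  ultimately show ?thesis
    using assms(1,3) by (simp add: test_functions_def smooth_def)
qed

section \<open>Integrals of compactly supported functions under translation\<close>

lemma integrable_compact_support:
  fixes F :: "'a::euclidean_space \<Rightarrow> 'b::euclidean_space"
  assumes "continuous_on UNIV F" "compact K" "\<And>x. x \<notin> K \<Longrightarrow> F x = 0"
  shows "integrable lborel F"
proof -
  have "(\<lambda>x. indicator K x *\<^sub>R F x) = F"
    using assms(3) by (auto simp: indicator_def)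
  then show ?thesis
    using borel_integrable_compact[OF assms(2) continuous_on_subset[OF assms(1)]] by simp
qed

lemma lborel_integral_translate:
  fixes F :: "'a::euclidean_space \<Rightarrow> 'b::euclidean_space"
  assumes [measurable]: "F \<in> borel_measurable borel"
  shows "(LINT x|lborel. F (x + y)) = (LINT x|lborel. F x)"
proof -
  have "(LINT x|lborel. F x) = (LINT x|distr lborel borel ((+) y). F x)"
    by (simp add: lborel_distr_plus)
  also have "\<dots> = (LINT x|lborel. F (x + y))"
    by (subst integral_distr) (auto simp: add.commute)
  finally show ?thesis ..
qed

lemma translate_compact_support:
  fixes K :: "'a::euclidean_space set"
  assumes "compact K"
  shows "compact ((\<lambda>z. z - y) ` K)" "x \<notin> (\<lambda>z. z - y) ` K \<Longrightarrow> x + y \<notin> K"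
  using assms by (auto simp: image_iff intro!: compact_continuous_image continuous_intros)

text \<open>After Fubini the inner integral, for fixed t, is that of a translate of
  \<open>F\<close>.\<close>

lemma segment_average:
  fixes F :: "'a::euclidean_space \<Rightarrow> real"
  assumes F: "continuous_on UNIV F" "compact K" "\<And>x. x \<notin> K \<Longrightarrow> F x = 0"
  shows "integrable lborel (\<lambda>x. LINT t|lborel. indicator {0..1} t *\<^sub>R F (x + t *\<^sub>R y))"
    and "(LINT x|lborel. LINT t|lborel. indicator {0..1} t *\<^sub>R F (x + t *\<^sub>R y)) = (LINT x|lborel. F x)"
proof -
  \<comment> \<open>All (x, t) with t in [0,1] and x + t y in K: a sheared product, hence compact,
    which yields the joint integrability for Fubini.\<close>
  define S where "S = (\<lambda>(z, t). (z - t *\<^sub>R y, t)) ` (K \<times> {0..1::real})"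
  have S: "compact S"
    unfolding S_def using F(2)
    by (intro compact_continuous_image compact_Times) (auto simp: split_def intro!: continuous_intros)
  have "continuous_on S (\<lambda>p. F (fst p + snd p *\<^sub>R y))"
    by (rule continuous_on_compose2[OF F(1)]) (auto intro!: continuous_intros)
  from borel_integrable_compact[OF S this]
  have "integrable lborel (\<lambda>p. indicator S p *\<^sub>R F (fst p + snd p *\<^sub>R y))" .
  also have "(\<lambda>p. indicator S p *\<^sub>R F (fst p + snd p *\<^sub>R y)) =
      (\<lambda>(x, t). indicator {0..1} t *\<^sub>R F (x + t *\<^sub>R y))"
  proof (intro ext, clarify)
    fix x t
    show "indicator S (x, t) *\<^sub>R F (fst (x, t) + snd (x, t) *\<^sub>R y) = indicator {0..1} t *\<^sub>R F (x + t *\<^sub>R y)"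
    proof (cases "x + t *\<^sub>R y \<in> K")
      case True
      then have "(x, t) \<in> S \<longleftrightarrow> t \<in> {0..1}"
        unfolding S_def by (force intro!: image_eqI[of _ _ "(x + t *\<^sub>R y, t)"])
      then show ?thesis by (simp add: indicator_def)
    qed (use F(3) in auto)
  qed
  finally have int: "integrable (lborel \<Otimes>\<^sub>M lborel) (\<lambda>(x, t). indicator {0..1} t *\<^sub>R F (x + t *\<^sub>R y))"
    by (simp add: lborel_prod)
  have [measurable]: "F \<in> borel_measurable borel"
    using F(1) by (rule borel_measurable_continuous_onI)
  show "integrable lborel (\<lambda>x. LINT t|lborel. indicator {0..1} t *\<^sub>R F (x + t *\<^sub>R y))"
    using lborel_pair.integrable_fst[OF int] .
  have "(LINT x|lborel. LINT t|lborel. indicator {0..1} t *\<^sub>R F (x + t *\<^sub>R y)) =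
      (LINT t|lborel. LINT x|lborel. indicator {0..1} t *\<^sub>R F (x + t *\<^sub>R y))"
    using lborel_pair.Fubini_integral[OF int] by simp
  also have "\<dots> = (LINT t|lborel. indicator {0..1::real} t *\<^sub>R (LINT x|lborel. F x))"
    by (simp add: lborel_integral_translate)
  also have "\<dots> = (LINT x|lborel. F x)" by simp
  finally show "(LINT x|lborel. LINT t|lborel. indicator {0..1} t *\<^sub>R F (x + t *\<^sub>R y)) = (LINT x|lborel. F x)" .
qed

lemma smooth_segment_FTC:
  assumes "smooth w"
  shows "(LINT t|lborel. indicator {0..1} t *\<^sub>R (grad w (x + t *\<^sub>R y) \<bullet> y)) = w (x + y) - w x"
proof -
  have "((\<lambda>t. w (x + t *\<^sub>R y)) has_vector_derivative (grad w (x + t *\<^sub>R y) \<bullet> y)) (at t within {0..1})" for t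
    unfolding has_vector_derivative_def
    by (rule has_derivative_eq_rhs[OF has_derivative_compose[OF _ smooth_has_derivative[OF assms]]])
      (auto intro!: derivative_eq_intros)
  moreover have "continuous_on {0..1} (\<lambda>t. grad w (x + t *\<^sub>R y) \<bullet> y)"
    by (intro continuous_intros continuous_on_compose2[OF smooth_continuous_on_grad[OF assms, of UNIV]]) auto
  ultimately show ?thesis
    using integral_FTC_atLeastAtMost[of 0 1 "\<lambda>t. w (x + t *\<^sub>R y)" "\<lambda>t. grad w (x + t *\<^sub>R y) \<bullet> y"]
    by simp
qed

text \<open>Averaging over segments preserves the integral and turns the directional derivative into
  w(x + y) - w(x), which integrates to 0 by translation invariance. This is the source of
  integration by parts below.\<close>

lemma integral_directional_derivative_eq_0:
  fixes w :: "'a::euclidean_space \<Rightarrow> real"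
  assumes w: "w \<in> test_functions D"
  shows "(LINT x|lborel. grad w x \<bullet> y) = 0"
proof -
  note wD = test_functionsD[OF w]
  obtain K where K: "compact K" "K \<subseteq> D" "\<And>x. x \<notin> K \<Longrightarrow> w x = 0" "\<And>x. x \<notin> K \<Longrightarrow> grad w x = 0"
    using test_functionsE[OF w] by blast
  have iw: "integrable lborel w"
    by (rule integrable_compact_support[OF wD(2) K(1,3)])
  have iw': "integrable lborel (\<lambda>x. w (x + y))"
  proof (rule integrable_compact_support[OF _ translate_compact_support(1)[OF K(1), of y]])
    show "continuous_on UNIV (\<lambda>x. w (x + y))"
      by (rule continuous_on_compose2[OF wD(2)[of UNIV]]) (auto intro!: continuous_intros)
  qed (use translate_compact_support[OF K(1)] K(3) in auto)
  have "(LINT x|lborel. grad w x \<bullet> y) =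
      (LINT x|lborel. LINT t|lborel. indicator {0..1} t *\<^sub>R (grad w (x + t *\<^sub>R y) \<bullet> y))"
    by (rule segment_average(2)[symmetric, of _ K])
      (use wD K in \<open>auto intro!: continuous_intros\<close>)
  also have "\<dots> = (LINT x|lborel. w (x + y) - w x)"
    by (simp only: smooth_segment_FTC[OF wD(1)])
  also have "\<dots> = 0"
    using iw iw' lborel_integral_translate[of w y] borel_measurable_continuous_onI[OF wD(2)[of UNIV]] by simp
  finally show ?thesis .
qed

text \<open>Jensen's inequality for the square: the variance of \<open>q\<close> is
  nonnegative.\<close>

lemma square_unit_average_le:
  fixes q :: "real \<Rightarrow> real"
  assumes "continuous_on {0..1} q"
  shows "(LINT t|lborel. indicator {0..1} t *\<^sub>R q t)\<^sup>2 \<le> (LINT t|lborel. indicator {0..1} t *\<^sub>R (q t)\<^sup>2)"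
proof -
  define m where "m = (LINT t|lborel. indicator {0..1} t *\<^sub>R q t)"
  have i: "integrable lborel (\<lambda>t. indicator {0..1} t *\<^sub>R q t)"
    "integrable lborel (\<lambda>t. indicator {0..1} t *\<^sub>R (q t)\<^sup>2)"
    using assms by (auto intro!: borel_integrable_compact continuous_intros simp del: real_scaleR_def)
  have i1: "integrable lborel (\<lambda>t. indicator {0..1::real} t * m\<^sup>2)" by simp
  have "0 \<le> (LINT t|lborel. indicator {0..1} t *\<^sub>R (q t - m)\<^sup>2)"
    by (intro integral_nonneg_AE) auto
  also have "\<dots> = (LINT t|lborel. indicator {0..1} t *\<^sub>R (q t)\<^sup>2 - 2 * m * (indicator {0..1} t *\<^sub>R q t)
      + indicator {0..1::real} t * m\<^sup>2)"
    by (intro Bochner_Integration.integral_cong) (auto simp: power2_eq_square algebra_simps)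
  also have "\<dots> = (LINT t|lborel. indicator {0..1} t *\<^sub>R (q t)\<^sup>2) - 2 * m * m + m\<^sup>2"
    using i i1 by (simp add: m_def)
  finally show ?thesis by (simp add: m_def power2_eq_square)
qed

text \<open>The increment is the integral of the derivative along the segment from x to x + y;
  Jensen moves the square inside, and \<open>segment_average\<close> removes the shift.\<close>

lemma integral_translation_difference_le:
  fixes w :: "'a::euclidean_space \<Rightarrow> real"
  assumes w: "w \<in> test_functions D"
  shows "(LINT x|lborel. (w (x + y) - w x)\<^sup>2) \<le> (norm y)\<^sup>2 * (LINT x|lborel. (norm (grad w x))\<^sup>2)"
proof -
  note wD = test_functionsD[OF w]
  obtain K where K: "compact K" "K \<subseteq> D" "\<And>x. x \<notin> K \<Longrightarrow> w x = 0" "\<And>x. x \<notin> K \<Longrightarrow> grad w x = 0"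
    using test_functionsE[OF w] by blast
  let ?F = "\<lambda>x. (grad w x \<bullet> y)\<^sup>2"
  have F: "continuous_on UNIV ?F" "\<And>x. x \<notin> K \<Longrightarrow> ?F x = 0"
    using wD K by (auto intro!: continuous_intros)
  have "(LINT x|lborel. (w (x + y) - w x)\<^sup>2) \<le>
      (LINT x|lborel. LINT t|lborel. indicator {0..1} t *\<^sub>R ?F (x + t *\<^sub>R y))"
  proof (rule integral_mono_AE')
    show "integrable lborel (\<lambda>x. LINT t|lborel. indicator {0..1} t *\<^sub>R ?F (x + t *\<^sub>R y))"
      by (rule segment_average(1)[OF F(1) K(1) F(2)])
    have "(w (x + y) - w x)\<^sup>2 \<le> (LINT t|lborel. indicator {0..1} t *\<^sub>R ?F (x + t *\<^sub>R y))" for x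
      unfolding smooth_segment_FTC[OF wD(1), symmetric]
      by (intro square_unit_average_le continuous_intros
          continuous_on_compose2[OF wD(3)[of UNIV]]) auto
    then show "AE x in lborel. (w (x + y) - w x)\<^sup>2 \<le> (LINT t|lborel. indicator {0..1} t *\<^sub>R ?F (x + t *\<^sub>R y))"
      by simp
  qed auto
  also have "\<dots> = (LINT x|lborel. ?F x)"
    by (rule segment_average(2)[OF F(1) K(1) F(2)])
  also have "\<dots> \<le> (LINT x|lborel. (norm y)\<^sup>2 * (norm (grad w x))\<^sup>2)"
  proof (rule integral_mono)
    show "integrable lborel ?F" by (rule integrable_compact_support[OF F(1) K(1) F(2)])
    show "integrable lborel (\<lambda>x. (norm y)\<^sup>2 * (norm (grad w x))\<^sup>2)"
      by (rule integrable_compact_support[OF _ K(1)]) (use wD K in \<open>auto intro!: continuous_intros\<close>)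
    show "?F x \<le> (norm y)\<^sup>2 * (norm (grad w x))\<^sup>2" for x
      using Cauchy_Schwarz_ineq[of "grad w x" y] by (simp add: power2_norm_eq_inner mult.commute)
  qed
  finally show ?thesis by simp
qed

text \<open>Averaging \<open>\<integral>w\<^sup>2 = \<integral>w(x)w(x+y) dx + \<integral>(w(x+y) - w(x))\<^sup>2 dx / 2\<close> over \<open>y\<close> in a ball.\<close>

lemma Nash_inequality:
  fixes w :: "'a::euclidean_space \<Rightarrow> real"
  assumes w: "w \<in> test_functions D" and \<rho>: "0 < \<rho>"
  shows "(LINT x|lborel. (w x)\<^sup>2) \<le>
      \<rho>\<^sup>2 / 2 * (LINT x|lborel. (norm (grad w x))\<^sup>2) + (LINT x|lborel. \<bar>w x\<bar>)\<^sup>2 / measure lborel (ball (0::'a) \<rho>)"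
proof -
  note wD = test_functionsD[OF w]
  obtain K where K: "compact K" "K \<subseteq> D" "\<And>x. x \<notin> K \<Longrightarrow> w x = 0" "\<And>x. x \<notin> K \<Longrightarrow> grad w x = 0"
    using test_functionsE[OF w] by blast
  define A where "A = (LINT x|lborel. (w x)\<^sup>2)"
  define B where "B = (LINT x|lborel. (norm (grad w x))\<^sup>2)"
  define J where "J = (\<lambda>y. LINT x|lborel. \<bar>w x\<bar> * \<bar>w (x + y)\<bar>)"
  have [measurable]: "w \<in> borel_measurable borel"
    by (rule borel_measurable_continuous_onI[OF wD(2)])
  have B0: "0 \<le> B" unfolding B_def by (intro integral_nonneg_AE) auto
  have cw: "continuous_on UNIV (\<lambda>x. w (x + y))" for y
    by (rule continuous_on_compose2[OF wD(2)[of UNIV]]) (auto intro!: continuous_intros)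
  have iw: "integrable lborel (\<lambda>x. \<bar>w x\<bar>)"
    by (rule integrable_compact_support[OF _ K(1)]) (use wD K in \<open>auto intro!: continuous_intros\<close>)
  have pointwise: "A \<le> \<rho>\<^sup>2 / 2 * B + J y" if "y \<in> ball 0 \<rho>" for y
  proof -
    have i1: "integrable lborel (\<lambda>x. (w x)\<^sup>2)"
      by (rule integrable_compact_support[OF _ K(1)]) (use wD K in \<open>auto intro!: continuous_intros\<close>)
    have i2: "integrable lborel (\<lambda>x. (w (x + y))\<^sup>2)"
      by (rule integrable_compact_support[OF _ translate_compact_support(1)[OF K(1), of y]])
        (use K(3) translate_compact_support[OF K(1)] cw in \<open>auto intro!: continuous_intros\<close>)
    have i3: "integrable lborel (\<lambda>x. w x * w (x + y))"
      by (rule integrable_compact_support[OF _ K(1)]) (use wD K cw in \<open>auto intro!: continuous_intros\<close>)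
    have i4: "integrable lborel (\<lambda>x. \<bar>w x\<bar> * \<bar>w (x + y)\<bar>)"
      using integrable_abs[OF i3] by (simp add: abs_mult)
    have "(LINT x|lborel. (w (x + y) - w x)\<^sup>2) =
        (LINT x|lborel. (w (x + y))\<^sup>2 + (w x)\<^sup>2 - 2 * (w x * w (x + y)))"
      by (simp add: power2_diff algebra_simps)
    also have "\<dots> = A + A - 2 * (LINT x|lborel. w x * w (x + y))"
      using i1 i2 i3 lborel_integral_translate[of "\<lambda>x. (w x)\<^sup>2" y] by (simp add: A_def)
    finally have "A = (LINT x|lborel. (w (x + y) - w x)\<^sup>2) / 2 + (LINT x|lborel. w x * w (x + y))"
      by linarith
    also have "\<dots> \<le> (norm y)\<^sup>2 * B / 2 + J y"
    proof (intro add_mono divide_right_mono)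
      show "(LINT x|lborel. w x * w (x + y)) \<le> J y"
        unfolding J_def using i3 i4
        by (rule integral_mono) (metis abs_ge_self abs_mult)
    qed (use integral_translation_difference_le[OF w] in \<open>auto simp: B_def\<close>)
    also have "\<dots> \<le> \<rho>\<^sup>2 / 2 * B + J y"
      using mult_right_mono[OF power_mono[of "norm y" \<rho> 2] B0] that by simp
    finally show ?thesis .
  qed
  \<comment> \<open>The pairs (x, y) with x and x + y both in K; the product of the two values of
    \<open>w\<close> vanishes outside this compact set.\<close>
  define S where "S = (\<lambda>(x, z). (x, z - x)) ` (K \<times> K)"
  have S: "compact S"
    unfolding S_def using K(1)
    by (intro compact_continuous_image compact_Times) (auto simp: split_def intro!: continuous_intros)
  have cont: "continuous_on UNIV (\<lambda>p. \<bar>w (fst p)\<bar> * \<bar>w (fst p + snd p)\<bar>)"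
    by (intro continuous_intros continuous_on_compose2[OF wD(2)[of UNIV]]) auto
  have "\<bar>w (fst p)\<bar> * \<bar>w (fst p + snd p)\<bar> = 0" if "p \<notin> S" for p
  proof -
    have "fst p \<notin> K \<or> fst p + snd p \<notin> K"
    proof (rule ccontr)
      assume "\<not> ?thesis"
      then have "p \<in> S"
        unfolding S_def by (intro image_eqI[of _ _ "(fst p, fst p + snd p)"]) auto
      with that show False by simp
    qed
    then show ?thesis using K(3) by auto
  qed
  from integrable_compact_support[OF cont S this]
  have int: "integrable (lborel \<Otimes>\<^sub>M lborel) (\<lambda>(x, y). \<bar>w x\<bar> * \<bar>w (x + y)\<bar>)"
    by (simp add: lborel_prod split_def)
  have "(LINT y|lborel. J y) = (LINT x|lborel. LINT y|lborel. \<bar>w x\<bar> * \<bar>w (x + y)\<bar>)"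
    unfolding J_def using lborel_pair.Fubini_integral[OF int] by simp
  also have "\<dots> = (LINT x|lborel. \<bar>w x\<bar> * (LINT y|lborel. \<bar>w y\<bar>))"
    using lborel_integral_translate[of "\<lambda>x. \<bar>w x\<bar>"] by (simp add: add.commute)
  also have "\<dots> = (LINT x|lborel. \<bar>w x\<bar>)\<^sup>2"
    by (simp add: power2_eq_square)
  finally have intJ: "(LINT y|lborel. J y) = (LINT x|lborel. \<bar>w x\<bar>)\<^sup>2" .
  have iJ: "integrable lborel J"
    unfolding J_def by (rule lborel_pair.integrable_snd[OF int])
  have J0: "0 \<le> J y" for y unfolding J_def by (intro integral_nonneg_AE) auto
  have fin: "emeasure lborel (ball (0::'a) \<rho>) < \<infinity>"
    by (rule emeasure_bounded_finite[OF bounded_ball])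
  \<comment> \<open>The pointwise bound is integrated over the ball; outside it \<open>J\<close> is
    nonnegative, so the full integral of \<open>J\<close> is an upper bound.\<close>
  have "(LINT y|lborel. indicator (ball (0::'a) \<rho>) y * (A - \<rho>\<^sup>2 / 2 * B)) \<le> (LINT y|lborel. J y)"
  proof (rule integral_mono)
    show "integrable lborel (\<lambda>y. indicator (ball (0::'a) \<rho>) y * (A - \<rho>\<^sup>2 / 2 * B))"
      by (rule integrable_mult_left) (use fin in \<open>simp add: integrable_indicator_iff\<close>)
    show "indicator (ball 0 \<rho>) y * (A - \<rho>\<^sup>2 / 2 * B) \<le> J y" for y
      using pointwise[of y] J0[of y] by (auto simp: indicator_def)
  qed (rule iJ)
  then have "measure lborel (ball (0::'a) \<rho>) * (A - \<rho>\<^sup>2 / 2 * B) \<le> (LINT x|lborel. \<bar>w x\<bar>)\<^sup>2"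
    using intJ fin by simp
  moreover have "0 < measure lborel (ball (0::'a) \<rho>)" using \<rho> by (rule content_ball_pos)
  ultimately show ?thesis
    by (simp add: A_def B_def field_simps)
qed

section \<open>Square integrable functions\<close>

lemma borel_measurable_lebesgue_on:
  "F \<in> borel_measurable borel \<Longrightarrow> F \<in> borel_measurable (lebesgue_on D)"
  by (intro measurable_restrict_space1 measurable_completion) simp

lemma continuous_imp_measurable_lebesgue_on:
  "continuous_on UNIV F \<Longrightarrow> F \<in> borel_measurable (lebesgue_on D)"
  by (intro borel_measurable_lebesgue_on borel_measurable_continuous_onI)

lemma integral_lebesgue_on_eq_lborel:
  fixes F :: "'a::euclidean_space \<Rightarrow> 'b::euclidean_space"
  assumes "F \<in> borel_measurable borel" "D \<in> sets lebesgue" "\<And>x. x \<notin> D \<Longrightarrow> F x = 0"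
  shows "integral\<^sup>L (lebesgue_on D) F = integral\<^sup>L lborel F"
proof -
  have "integral\<^sup>L (lebesgue_on D) F = (LINT x|lebesgue. (if x \<in> D then F x else 0))"
    by (rule Lebesgue_Measure.integral_restrict_UNIV[OF assms(2), symmetric])
  also have "(\<lambda>x. if x \<in> D then F x else 0) = F" using assms(3) by auto
  finally show ?thesis using assms(1) by (simp add: integral_completion)
qed

lemma L2D:
  assumes "F \<in> L2 D"
  shows "F \<in> borel_measurable (lebesgue_on D)" "integrable (lebesgue_on D) (\<lambda>x. (norm (F x))\<^sup>2)"
  using assms by (auto simp: L2_def)

lemma L2_bound:
  assumes "F \<in> L2 D" "H \<in> borel_measurable (lebesgue_on D)"
    and "AE x in lebesgue_on D. norm (H x) \<le> norm (F x)"
  shows "H \<in> L2 D"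
proof -
  note [measurable] = assms(2)
  have "integrable (lebesgue_on D) (\<lambda>x. (norm (H x))\<^sup>2)"
    by (rule Bochner_Integration.integrable_bound[OF L2D(2)[OF assms(1)]])
      (use assms(3) in \<open>auto elim!: eventually_mono intro: power_mono\<close>)
  then show ?thesis using assms(2) by (simp add: L2_def)
qed

lemma norm_add_sq_le:
  fixes x y :: "'a::real_normed_vector"
  shows "(norm (x + y))\<^sup>2 \<le> 2 * (norm x)\<^sup>2 + 2 * (norm y)\<^sup>2"
proof -
  have "(norm (x + y))\<^sup>2 \<le> (norm x + norm y)\<^sup>2"
    by (intro power_mono norm_triangle_ineq norm_ge_zero)
  also have "\<dots> \<le> 2 * (norm x)\<^sup>2 + 2 * (norm y)\<^sup>2"
    using sum_squares_bound[of "norm x" "norm y"] by (simp add: power2_sum)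
  finally show ?thesis .
qed

lemma L2_add:
  assumes "F \<in> L2 D" "H \<in> L2 D"
  shows "(\<lambda>x. F x + H x) \<in> L2 D"
proof -
  note [measurable] = L2D(1)[OF assms(1)] L2D(1)[OF assms(2)]
  have "integrable (lebesgue_on D) (\<lambda>x. 2 * (norm (F x))\<^sup>2 + 2 * (norm (H x))\<^sup>2)"
    using L2D(2)[OF assms(1)] L2D(2)[OF assms(2)] by simp
  then have "integrable (lebesgue_on D) (\<lambda>x. (norm (F x + H x))\<^sup>2)"
    by (rule Bochner_Integration.integrable_bound) (simp_all add: norm_add_sq_le order_trans[OF norm_add_sq_le abs_ge_self])
  then show ?thesis by (simp add: L2_def)
qed

lemma L2_scaleR: "F \<in> L2 D \<Longrightarrow> (\<lambda>x. c *\<^sub>R F x) \<in> L2 D"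
  by (auto simp: L2_def power_mult_distrib)

lemma L2_diff: "F \<in> L2 D \<Longrightarrow> H \<in> L2 D \<Longrightarrow> (\<lambda>x. F x - H x) \<in> L2 D"
  using L2_add[OF _ L2_scaleR[of H D "-1"], of F] by simp

lemma L2_norm: "F \<in> L2 D \<Longrightarrow> (\<lambda>x. norm (F x)) \<in> L2 D"
  by (auto simp: L2_def)

lemma L2_mult_bounded:
  assumes "F \<in> L2 D" "b \<in> borel_measurable (lebesgue_on D)"
    and "AE x in lebesgue_on D. \<bar>b x\<bar> \<le> C"
  shows "(\<lambda>x. b x *\<^sub>R F x) \<in> L2 D"
proof (rule L2_bound[OF L2_scaleR[of F D C]])
  show "(\<lambda>x. b x *\<^sub>R F x) \<in> borel_measurable (lebesgue_on D)"
    using assms(2) L2D(1)[OF assms(1)] by (rule borel_measurable_scaleR)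
  show "AE x in lebesgue_on D. norm (b x *\<^sub>R F x) \<le> norm (C *\<^sub>R F x)"
    using assms(3) by (rule eventually_mono) (auto intro: mult_right_mono)
qed (fact assms(1))

lemma L2_norm_product_integrable:
  assumes "F \<in> L2 D" "H \<in> L2 D"
  shows "integrable (lebesgue_on D) (\<lambda>x. norm (F x) * norm (H x))"
proof (rule Bochner_Integration.integrable_bound)
  note [measurable] = L2D(1)[OF assms(1)] L2D(1)[OF assms(2)]
  show "integrable (lebesgue_on D) (\<lambda>x. (norm (F x))\<^sup>2 + (norm (H x))\<^sup>2)"
    using L2D(2)[OF assms(1)] L2D(2)[OF assms(2)] by simp
  show "(\<lambda>x. norm (F x) * norm (H x)) \<in> borel_measurable (lebesgue_on D)" by simp
  have "norm (F x) * norm (H x) \<le> (norm (F x))\<^sup>2 + (norm (H x))\<^sup>2" for x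
  proof -
    have "0 \<le> norm (F x) * norm (H x)" by simp
    then show ?thesis using sum_squares_bound[of "norm (F x)" "norm (H x)"] by linarith
  qed
  then show "AE x in lebesgue_on D. norm (norm (F x) * norm (H x)) \<le> norm ((norm (F x))\<^sup>2 + (norm (H x))\<^sup>2)"
    by simp
qed

lemma L2_inner_integrable:
  assumes "F \<in> L2 D" "H \<in> L2 D"
  shows "integrable (lebesgue_on D) (\<lambda>x. F x \<bullet> H x)"
proof (rule Bochner_Integration.integrable_bound[OF L2_norm_product_integrable[OF assms]])
  note [measurable] = L2D(1)[OF assms(1)] L2D(1)[OF assms(2)]
  show "(\<lambda>x. F x \<bullet> H x) \<in> borel_measurable (lebesgue_on D)" by simp
qed (simp add: Cauchy_Schwarz_ineq2)

text \<open>The integral of (t |F| - |H|)^2 is a nonnegative quadratic in t, so its discriminant is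
  not positive.\<close>

lemma L2_Cauchy_Schwarz:
  assumes "F \<in> L2 D" "H \<in> L2 D"
  shows "(LINT x|lebesgue_on D. norm (F x) * norm (H x))\<^sup>2 \<le>
    (LINT x|lebesgue_on D. (norm (F x))\<^sup>2) * (LINT x|lebesgue_on D. (norm (H x))\<^sup>2)"
proof -
  define A where "A = (LINT x|lebesgue_on D. (norm (F x))\<^sup>2)"
  define B where "B = (LINT x|lebesgue_on D. norm (F x) * norm (H x))"
  define C where "C = (LINT x|lebesgue_on D. (norm (H x))\<^sup>2)"
  note int = L2D(2)[OF assms(1)] L2D(2)[OF assms(2)] L2_norm_product_integrable[OF assms]
  have quad: "0 \<le> t\<^sup>2 * A - 2 * t * B + C" for t
  proof -
    have "0 \<le> (LINT x|lebesgue_on D. (t * norm (F x) - norm (H x))\<^sup>2)"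
      by (intro integral_nonneg_AE) auto
    also have "\<dots> = (LINT x|lebesgue_on D. t\<^sup>2 * (norm (F x))\<^sup>2 - 2 * t * (norm (F x) * norm (H x)) + (norm (H x))\<^sup>2)"
      by (intro Bochner_Integration.integral_cong refl) (simp add: power2_eq_square algebra_simps)
    also have "\<dots> = t\<^sup>2 * A - 2 * t * B + C"
      using int by (simp add: A_def B_def C_def)
    finally show ?thesis .
  qed
  have A0: "0 \<le> A" unfolding A_def by (intro integral_nonneg_AE) auto
  have "B\<^sup>2 \<le> A * C"
  proof (cases "A = 0")
    case True
    have "B = 0"
    proof (rule ccontr)
      assume "B \<noteq> 0"
      \<comment> \<open>For A = 0 the quadratic is C - 2 t B, and this t gives it the value
        -1.\<close>
      then show False using quad[of "(C + 1) / (2 * B)"] True by simp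
    qed
    then show ?thesis using True by simp
  next
    case False
    then have "0 < A" using A0 by simp
    moreover from this quad[of "B / A"] have "0 \<le> C - B\<^sup>2 / A"
      by (simp add: power2_eq_square)
    ultimately show ?thesis by (simp add: field_simps)
  qed
  then show ?thesis by (simp add: A_def B_def C_def)
qed

text \<open>The Bochner integral of a nonintegrable function is 0, so this expresses convergence
  only for members of \<open>L2 D\<close>; the lemmas that take it as a hypothesis assume membership
  separately.\<close>

definition L2_tendsto ::
    "'a::euclidean_space set \<Rightarrow> (nat \<Rightarrow> 'a \<Rightarrow> 'b::euclidean_space) \<Rightarrow> ('a \<Rightarrow> 'b) \<Rightarrow> bool" where
  "L2_tendsto D F H \<longleftrightarrow> (\<lambda>n. LINT x|lebesgue_on D. (norm (F n x - H x))\<^sup>2) \<longlonglongrightarrow> 0"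

lemma L2_tendsto_norm_product:
  assumes K: "K \<in> L2 D" and F: "\<And>n. F n \<in> L2 D" and H: "H \<in> L2 D" and lim: "L2_tendsto D F H"
  shows "(\<lambda>n. LINT x|lebesgue_on D. norm (K x) * norm (F n x - H x)) \<longlonglongrightarrow> 0"
proof -
  let ?A = "LINT x|lebesgue_on D. (norm (K x))\<^sup>2"
  have "(\<lambda>n. sqrt (?A * (LINT x|lebesgue_on D. (norm (F n x - H x))\<^sup>2))) \<longlonglongrightarrow> sqrt (?A * 0)"
    using lim unfolding L2_tendsto_def by (intro tendsto_intros)
  then have "(\<lambda>n. sqrt (?A * (LINT x|lebesgue_on D. (norm (F n x - H x))\<^sup>2))) \<longlonglongrightarrow> 0" by simp
  then show ?thesis
  proof (rule Lim_null_comparison[rotated], intro always_eventually allI)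
    fix n
    show "norm (LINT x|lebesgue_on D. norm (K x) * norm (F n x - H x)) \<le>
        sqrt (?A * (LINT x|lebesgue_on D. (norm (F n x - H x))\<^sup>2))"
      using L2_Cauchy_Schwarz[OF K L2_diff[OF F H], of n] by (simp add: real_le_rsqrt)
  qed
qed

lemma L2_tendsto_inner:
  assumes K: "K \<in> L2 D" and F: "\<And>n. F n \<in> L2 D" and H: "H \<in> L2 D" and lim: "L2_tendsto D F H"
  shows "(\<lambda>n. LINT x|lebesgue_on D. K x \<bullet> F n x) \<longlonglongrightarrow> (LINT x|lebesgue_on D. K x \<bullet> H x)"
proof (rule LIM_zero_cancel, rule Lim_null_comparison[OF always_eventually L2_tendsto_norm_product[OF assms]], rule allI)
  fix n
  have FH: "(\<lambda>x. F n x - H x) \<in> L2 D" using F H by (rule L2_diff)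
  have "(LINT x|lebesgue_on D. K x \<bullet> F n x) - (LINT x|lebesgue_on D. K x \<bullet> H x) =
      (LINT x|lebesgue_on D. K x \<bullet> (F n x - H x))"
    using L2_inner_integrable[OF K F] L2_inner_integrable[OF K H] by (simp add: inner_diff_right)
  also have "norm \<dots> \<le> (LINT x|lebesgue_on D. norm (K x \<bullet> (F n x - H x)))"
    by (rule integral_norm_bound)
  also have "\<dots> \<le> (LINT x|lebesgue_on D. norm (K x) * norm (F n x - H x))"
    using L2_inner_integrable[OF K FH] L2_norm_product_integrable[OF K FH]
    by (intro integral_mono integrable_norm) (simp_all add: Cauchy_Schwarz_ineq2)
  finally show "norm ((LINT x|lebesgue_on D. K x \<bullet> F n x) - (LINT x|lebesgue_on D. K x \<bullet> H x)) \<le>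
    (LINT x|lebesgue_on D. norm (K x) * norm (F n x - H x))" .
qed

text \<open>In |F|^2 = |F - H|^2 + 2 (H, F) - |H|^2 the first term tends to 0 and the second
  converges by \<open>L2_tendsto_inner\<close>.\<close>

lemma L2_tendsto_norm_sq:
  assumes F: "\<And>n. F n \<in> L2 D" and H: "H \<in> L2 D" and lim: "L2_tendsto D F H"
  shows "(\<lambda>n. LINT x|lebesgue_on D. (norm (F n x))\<^sup>2) \<longlonglongrightarrow> (LINT x|lebesgue_on D. (norm (H x))\<^sup>2)"
proof -
  have "(LINT x|lebesgue_on D. (norm (F n x))\<^sup>2) =
      (LINT x|lebesgue_on D. (norm (F n x - H x))\<^sup>2) + 2 * (LINT x|lebesgue_on D. H x \<bullet> F n x) -
      (LINT x|lebesgue_on D. (norm (H x))\<^sup>2)" for n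
  proof -
    have "(LINT x|lebesgue_on D. (norm (F n x))\<^sup>2) =
        (LINT x|lebesgue_on D. (norm (F n x - H x))\<^sup>2 + 2 * (H x \<bullet> F n x) - (norm (H x))\<^sup>2)"
      by (intro Bochner_Integration.integral_cong refl)
        (simp add: power2_norm_eq_inner inner_diff_left inner_diff_right inner_commute)
    then show ?thesis
      using L2D(2)[OF L2_diff[OF F[of n] H]] L2D(2)[OF H] L2_inner_integrable[OF H F[of n]] by simp
  qed
  moreover have "(\<lambda>n. (LINT x|lebesgue_on D. (norm (F n x - H x))\<^sup>2) + 2 * (LINT x|lebesgue_on D. H x \<bullet> F n x) -
      (LINT x|lebesgue_on D. (norm (H x))\<^sup>2)) \<longlonglongrightarrow>
      0 + 2 * (LINT x|lebesgue_on D. H x \<bullet> H x) - (LINT x|lebesgue_on D. (norm (H x))\<^sup>2)"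
    using lim unfolding L2_tendsto_def
    by (intro tendsto_intros L2_tendsto_inner[OF H F H]) (auto simp: L2_tendsto_def)
  ultimately show ?thesis by (simp add: power2_norm_eq_inner)
qed

section \<open>Bounded open sets: constants are square integrable, test functions lie in
  \<open>H10\<close>\<close>

locale bounded_open_set =
  fixes D :: "'a::euclidean_space set"
  assumes open_D: "open D" and bounded_D: "bounded D"
begin

lemma sets_D: "D \<in> sets lebesgue" "D \<in> lmeasurable"
  using open_D bounded_D by (auto intro: lmeasurable_open)

lemma finite_measure_D: "finite_measure (lebesgue_on D)"
  by (rule finite_measure_lebesgue_on[OF sets_D(2)])

lemma L2_const: "(\<lambda>x. c) \<in> L2 D"
  using finite_measure.integrable_const[OF finite_measure_D] by (simp add: L2_def)

lemma L2_integrable: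
  fixes F :: "'a \<Rightarrow> real"
  assumes "F \<in> L2 D"
  shows "integrable (lebesgue_on D) F"
  using L2_inner_integrable[OF L2_const[of "1::real"] assms] by simp

lemma L2_bounded:
  assumes "H \<in> borel_measurable (lebesgue_on D)" "AE x in lebesgue_on D. norm (H x) \<le> C"
  shows "H \<in> L2 D"
  by (rule L2_bound[OF L2_const[of C] assms(1)], use assms(2) in \<open>rule eventually_mono\<close>) auto

lemma L2_tendsto_abs_integral:
  fixes F :: "nat \<Rightarrow> 'a \<Rightarrow> real"
  assumes F: "\<And>n. F n \<in> L2 D" and H: "H \<in> L2 D" and lim: "L2_tendsto D F H"
  shows "(\<lambda>n. LINT x|lebesgue_on D. \<bar>F n x\<bar>) \<longlonglongrightarrow> (LINT x|lebesgue_on D. \<bar>H x\<bar>)"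
proof (rule LIM_zero_cancel, rule Lim_null_comparison[OF always_eventually
    L2_tendsto_norm_product[OF L2_const[of "1::real"] assms]], rule allI)
  fix n
  have i: "integrable (lebesgue_on D) (\<lambda>x. \<bar>F n x\<bar>)" "integrable (lebesgue_on D) (\<lambda>x. \<bar>H x\<bar>)"
    "integrable (lebesgue_on D) (\<lambda>x. \<bar>F n x - H x\<bar>)"
    using F H L2_diff[OF F H, of n] by (auto intro!: L2_integrable integrable_abs)
  have "(LINT x|lebesgue_on D. \<bar>F n x\<bar>) - (LINT x|lebesgue_on D. \<bar>H x\<bar>) =
      (LINT x|lebesgue_on D. \<bar>F n x\<bar> - \<bar>H x\<bar>)"
    using i by simp
  also have "norm \<dots> \<le> (LINT x|lebesgue_on D. norm (\<bar>F n x\<bar> - \<bar>H x\<bar>))"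
    by (rule integral_norm_bound)
  also have "\<dots> \<le> (LINT x|lebesgue_on D. norm (1::real) * norm (F n x - H x))"
    using i by (intro integral_mono integrable_norm) auto
  finally show "norm ((LINT x|lebesgue_on D. \<bar>F n x\<bar>) - (LINT x|lebesgue_on D. \<bar>H x\<bar>)) \<le>
    (LINT x|lebesgue_on D. norm (1::real) * norm (F n x - H x))" .
qed

lemma continuous_compact_support_L2:
  fixes F :: "'a \<Rightarrow> 'b::euclidean_space"
  assumes "continuous_on UNIV F" "compact K" "\<And>x. x \<notin> K \<Longrightarrow> F x = 0"
  shows "F \<in> L2 D"
proof -
  have "compact (F ` K)"
    using assms(1,2) by (intro compact_continuous_image continuous_on_subset[OF assms(1)]) auto
  then obtain B where B: "\<And>y. y \<in> F ` K \<Longrightarrow> norm y \<le> B"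
    using compact_imp_bounded bounded_iff by metis
  have "norm (F x) \<le> max B 0" for x
    using B[of "F x"] assms(3)[of x] by (cases "x \<in> K") auto
  then show ?thesis
    by (intro L2_bounded[of F "max B 0"] continuous_imp_measurable_lebesgue_on assms(1)) auto
qed

lemma test_function_L2:
  assumes "\<phi> \<in> test_functions D"
  shows "\<phi> \<in> L2 D" "grad \<phi> \<in> L2 D"
proof -
  obtain K where K: "compact K" "K \<subseteq> D" "\<And>x. x \<notin> K \<Longrightarrow> \<phi> x = 0" "\<And>x. x \<notin> K \<Longrightarrow> grad \<phi> x = 0"
    using test_functionsE[OF assms] by blast
  show "\<phi> \<in> L2 D"
    by (rule continuous_compact_support_L2[OF test_functionsD(2)[OF assms] K(1,3)])
  show "grad \<phi> \<in> L2 D"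
    by (rule continuous_compact_support_L2[OF test_functionsD(3)[OF assms] K(1,4)])
qed

lemma test_functions_mult:
  assumes "\<phi> \<in> test_functions D" "smooth \<psi>"
  shows "(\<lambda>x. \<phi> x * \<psi> x) \<in> test_functions D"
proof -
  obtain K where K: "compact K" "K \<subseteq> D" "\<And>x. x \<notin> K \<Longrightarrow> \<phi> x = 0" "\<And>x. x \<notin> K \<Longrightarrow> grad \<phi> x = 0"
    using test_functionsE[OF assms(1)] by blast
  show ?thesis
    by (rule test_functionsI[OF smooth_mult[OF test_functionsD(1)[OF assms(1)] assms(2)] K(1,2)])
      (simp add: K(3))
qed

text \<open>The product of two test functions is a test function, and the integral of its gradient
  vanishes in every direction; the product rule turns this into integration by parts.\<close>

lemma test_function_weak_gradient:
  assumes \<phi>: "\<phi> \<in> test_functions D"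
  shows "weak_gradient D \<phi> (grad \<phi>)"
  unfolding weak_gradient_def locally_integrable_def
proof (intro conjI allI impI ballI)
  fix K :: "'a set" assume K: "compact K \<and> K \<subseteq> D"
  then have "K \<in> lmeasurable" by (simp add: lmeasurable_compact)
  obtain S where S: "compact S" "S \<subseteq> D" "\<And>x. x \<notin> S \<Longrightarrow> \<phi> x = 0" "\<And>x. x \<notin> S \<Longrightarrow> grad \<phi> x = 0"
    using test_functionsE[OF \<phi>] by blast
  have restrict: "integrable (lebesgue_on K) F" if "integrable lborel F" for F :: "'a \<Rightarrow> 'b::euclidean_space"
  proof -
    have "integrable lebesgue F"
      using that by (simp add: integrable_completion)
    from integrable_mult_indicator[OF _ this, of K] show ?thesis
      using \<open>K \<in> lmeasurable\<close> by (simp add: integrable_restrict_space fmeasurableD)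
  qed
  show "integrable (lebesgue_on K) \<phi>"
    by (rule restrict[OF integrable_compact_support[OF test_functionsD(2)[OF \<phi>] S(1,3)]])
  show "integrable (lebesgue_on K) (grad \<phi>)"
    by (rule restrict[OF integrable_compact_support[OF test_functionsD(3)[OF \<phi>] S(1,4)]])
next
  fix \<psi> assume \<psi>: "\<psi> \<in> test_functions D"
  obtain S where S: "compact S" "S \<subseteq> D" "\<And>x. x \<notin> S \<Longrightarrow> \<phi> x = 0" "\<And>x. x \<notin> S \<Longrightarrow> grad \<phi> x = 0"
    using test_functionsE[OF \<phi>] by blast
  note c = test_functionsD(2)[OF \<phi>, of UNIV] test_functionsD(3)[OF \<phi>, of UNIV]
    test_functionsD(2)[OF \<psi>, of UNIV] test_functionsD(3)[OF \<psi>, of UNIV]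
  let ?F = "\<lambda>x. \<phi> x *\<^sub>R grad \<psi> x" and ?H = "\<lambda>x. \<psi> x *\<^sub>R grad \<phi> x"
  have cF: "continuous_on UNIV ?F" and cH: "continuous_on UNIV ?H"
    using c by (auto intro!: continuous_intros)
  have iF: "integrable lborel ?F"
    by (rule integrable_compact_support[OF cF S(1)]) (simp add: S)
  have iH: "integrable lborel ?H"
    by (rule integrable_compact_support[OF cH S(1)]) (simp add: S)
  note i = iF iH
  have pw: "grad (\<lambda>x. \<phi> x * \<psi> x) x = ?F x + ?H x" for x
    by (rule grad_mult[OF test_functionsD(1)[OF \<phi>] test_functionsD(1)[OF \<psi>]])
  have "(LINT x|lborel. ?F x + ?H x) \<bullet> b = 0" for b
  proof -
    have "(LINT x|lborel. ?F x + ?H x) \<bullet> b = (LINT x|lborel. (?F x + ?H x) \<bullet> b)"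
      using i by (intro integral_inner_left[symmetric]) auto
    also have "\<dots> = 0"
      using integral_directional_derivative_eq_0[OF test_functions_mult[OF \<phi> test_functionsD(1)[OF \<psi>]], of b]
      by (simp only: pw)
    finally show ?thesis .
  qed
  \<comment> \<open>Take for \<open>b\<close> the vector itself.\<close>
  then have "(LINT x|lborel. ?F x + ?H x) = 0"
    by (metis inner_eq_zero_iff)
  then have "(LINT x|lborel. ?F x) + (LINT x|lborel. ?H x) = 0" using i by simp
  moreover have "integral\<^sup>L (lebesgue_on D) ?F = integral\<^sup>L lborel ?F" "integral\<^sup>L (lebesgue_on D) ?H = integral\<^sup>L lborel ?H"
    using S by (intro integral_lebesgue_on_eq_lborel borel_measurable_continuous_onI cF cH sets_D; force)+
  ultimately show "(LINT x|lebesgue_on D. \<phi> x *\<^sub>R grad \<psi> x) = - (LINT x|lebesgue_on D. \<psi> x *\<^sub>R grad \<phi> x)"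
    by (simp add: eq_neg_iff_add_eq_0)
qed

lemma test_function_H10:
  assumes "\<phi> \<in> test_functions D"
  shows "\<phi> \<in> H10 D"
  unfolding H10_def
proof (intro CollectI conjI exI)
  show "\<phi> \<in> L2 D" "grad \<phi> \<in> L2 D" "weak_gradient D \<phi> (grad \<phi>)"
    using assms test_function_L2 test_function_weak_gradient by simp_all
  show "\<forall>n::nat. \<phi> \<in> test_functions D" using assms by simp
qed simp

end

section \<open>Limits of test functions\<close>

lemma L2_tendsto_squeeze:
  assumes "\<And>n. integrable (lebesgue_on D) (e n)" "(\<lambda>n. LINT x|lebesgue_on D. e n x) \<longlonglongrightarrow> (0::real)"
    and "\<And>n x. (norm (F n x - H x))\<^sup>2 \<le> e n x"
  shows "L2_tendsto D F H"
  unfolding L2_tendsto_def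
proof (rule Lim_null_comparison[OF always_eventually assms(2)], rule allI)
  fix n
  have "(LINT x|lebesgue_on D. (norm (F n x - H x))\<^sup>2) \<le> (LINT x|lebesgue_on D. e n x)"
    using assms(3) order_trans[OF zero_le_power2 assms(3)]
    by (intro integral_mono_AE' assms(1)) auto
  then show "norm (LINT x|lebesgue_on D. (norm (F n x - H x))\<^sup>2) \<le> (LINT x|lebesgue_on D. e n x)"
    by simp
qed

lemma L2_dominated_convergence:
  assumes W: "W \<in> L2 D" and F: "\<And>n. F n \<in> borel_measurable (lebesgue_on D)"
    and H: "H \<in> borel_measurable (lebesgue_on D)"
    and lim: "AE x in lebesgue_on D. (\<lambda>n. F n x) \<longlonglongrightarrow> H x"
    and bound: "\<And>n x. norm (F n x) \<le> (W x :: real)"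
  shows "H \<in> L2 D" "L2_tendsto D F H"
proof -
  note [measurable] = F H
  have H_bound: "AE x in lebesgue_on D. norm (H x) \<le> W x"
    using lim
  proof (rule eventually_mono)
    fix x assume "(\<lambda>n. F n x) \<longlonglongrightarrow> H x"
    then show "norm (H x) \<le> W x"
      using bound by (intro LIMSEQ_le_const2[OF tendsto_norm]) auto
  qed
  show "H \<in> L2 D"
    by (rule L2_bound[OF W H], rule eventually_mono[OF H_bound]) simp
  have "(\<lambda>n. LINT x|lebesgue_on D. (norm (F n x - H x))\<^sup>2) \<longlonglongrightarrow> (LINT x|lebesgue_on D. 0)"
  proof (rule integral_dominated_convergence[where w = "\<lambda>x. (2 * W x)\<^sup>2"])
    show "integrable (lebesgue_on D) (\<lambda>x. (2 * W x)\<^sup>2)"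
      using L2D(2)[OF W] by (simp add: power_mult_distrib)
    show "AE x in lebesgue_on D. (\<lambda>n. (norm (F n x - H x))\<^sup>2) \<longlonglongrightarrow> 0"
      using lim by (rule eventually_mono) (auto intro!: tendsto_eq_intros)
    show "AE x in lebesgue_on D. norm ((norm (F n x - H x))\<^sup>2) \<le> (2 * W x)\<^sup>2" for n
      using H_bound
    proof (rule eventually_mono)
      fix x assume "norm (H x) \<le> W x"
      then have "norm (F n x - H x) \<le> 2 * W x"
        using norm_triangle_ineq4[of "F n x" "H x"] bound[of n x] by linarith
      from power_mono[OF this norm_ge_zero, of 2] show "norm ((norm (F n x - H x))\<^sup>2) \<le> (2 * W x)\<^sup>2"
        by simp
    qed
  qed simp_all
  then show "L2_tendsto D F H" by (simp add: L2_tendsto_def)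
qed

text \<open>The difference of the two sides is the sum of the squared pairwise distances.\<close>

lemma norm_sum3_sq:
  fixes x y z :: "'a::real_inner"
  shows "(norm (x + y + z))\<^sup>2 \<le> 3 * ((norm x)\<^sup>2 + (norm y)\<^sup>2 + (norm z)\<^sup>2)"
proof -
  have "0 \<le> (norm (x - y))\<^sup>2 + (norm (y - z))\<^sup>2 + (norm (x - z))\<^sup>2" by simp
  then show ?thesis
    by (simp add: power2_norm_eq_inner inner_diff_left inner_diff_right inner_add_left inner_add_right inner_commute)
qed

text \<open>Here \<open>g\<close> is the gradient that comes with the approximating sequence in
  \<open>H10\<close>, so that \<open>(u, g)\<close> is a joint limit of test functions and their
  gradients. The equation is assumed against test functions only; all further test pairs arise as
  limits.\<close>

locale weak_problem = bounded_open_set D for D :: "'a::euclidean_space set" +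
  fixes a f u :: "'a \<Rightarrow> real" and g :: "'a \<Rightarrow> 'a" and \<phi> :: "nat \<Rightarrow> 'a \<Rightarrow> real" and lam Lam c_f :: real
  assumes lam_pos: "0 < lam" and Lam_pos: "0 < Lam" and c_f_pos: "0 < c_f"
    and a_measurable: "a \<in> borel_measurable (lebesgue_on D)"
    and a_bounds: "AE x in lebesgue_on D. lam \<le> a x \<and> a x \<le> Lam"
    and f_L2: "f \<in> L2 D" and f_bound: "AE x in lebesgue_on D. c_f \<le> f x"
    and u_L2: "u \<in> L2 D" and g_L2: "g \<in> L2 D"
    and equation: "\<And>v. v \<in> test_functions D \<Longrightarrow>
      (LINT x|lebesgue_on D. a x * (g x \<bullet> grad v x)) = (LINT x|lebesgue_on D. f x * v x)"
    and \<phi>_test: "\<And>n. \<phi> n \<in> test_functions D"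
    and \<phi>_tendsto: "L2_tendsto D \<phi> u" and grad_\<phi>_tendsto: "L2_tendsto D (\<lambda>n. grad (\<phi> n)) g"
begin

lemmas [measurable] = a_measurable L2D(1)[OF f_L2] L2D(1)[OF u_L2] L2D(1)[OF g_L2]

lemma ag_L2: "(\<lambda>x. a x *\<^sub>R g x) \<in> L2 D"
proof (rule L2_mult_bounded[OF g_L2 a_measurable])
  show "AE x in lebesgue_on D. \<bar>a x\<bar> \<le> Lam"
    by (rule eventually_mono[OF a_bounds]) (use lam_pos in auto)
qed

text \<open>The properties of test functions and their gradients that survive \<open>H\<^sup>1\<close> limits and that the
  argument needs. Working with them avoids weak derivatives of truncations of \<open>u\<close>.\<close>

definition admissible_pair :: "('a \<Rightarrow> real) \<Rightarrow> ('a \<Rightarrow> 'a) \<Rightarrow> bool" where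
  "admissible_pair v h \<longleftrightarrow> v \<in> L2 D \<and> h \<in> L2 D \<and>
     (LINT x|lebesgue_on D. a x * (g x \<bullet> h x)) = (LINT x|lebesgue_on D. f x * v x) \<and>
     (\<forall>\<rho>>0. (LINT x|lebesgue_on D. (v x)\<^sup>2) \<le> \<rho>\<^sup>2 / 2 * (LINT x|lebesgue_on D. (norm (h x))\<^sup>2) +
        (LINT x|lebesgue_on D. \<bar>v x\<bar>)\<^sup>2 / measure lborel (ball (0::'a) \<rho>))"

lemma admissible_pair_test_function:
  assumes v: "v \<in> test_functions D"
  shows "admissible_pair v (grad v)"
proof -
  obtain K where K: "compact K" "K \<subseteq> D" "\<And>x. x \<notin> K \<Longrightarrow> v x = 0" "\<And>x. x \<notin> K \<Longrightarrow> grad v x = 0"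
    using test_functionsE[OF v] by blast
  note c = test_functionsD(2,3)[OF v, of UNIV]
  have "(LINT x|lebesgue_on D. (v x)\<^sup>2) = (LINT x|lborel. (v x)\<^sup>2)"
    "(LINT x|lebesgue_on D. (norm (grad v x))\<^sup>2) = (LINT x|lborel. (norm (grad v x))\<^sup>2)"
    "(LINT x|lebesgue_on D. \<bar>v x\<bar>) = (LINT x|lborel. \<bar>v x\<bar>)"
    using K(2-4) c
    by (intro integral_lebesgue_on_eq_lborel borel_measurable_continuous_onI sets_D
        continuous_intros; force)+
  then show ?thesis
    using Nash_inequality[OF v] equation[OF v] test_function_L2[OF v]
    by (simp add: admissible_pair_def)
qed

text \<open>Both sides of the equation are bounded linear functionals of the pair, since
  \<open>a g\<close> and \<open>f\<close> are in L2. All terms of Nash's inequality are continuous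
  under L2 convergence, the L1 norm because D has finite measure.\<close>

lemma admissible_pair_limit:
  assumes pairs: "\<And>n. admissible_pair (v n) (h n)"
    and L2: "w \<in> L2 D" "k \<in> L2 D" and lim: "L2_tendsto D v w" "L2_tendsto D h k"
  shows "admissible_pair w k"
  unfolding admissible_pair_def
proof (intro conjI L2 allI impI)
  note p = pairs[unfolded admissible_pair_def]
  have L2n: "\<And>n. v n \<in> L2 D" "\<And>n. h n \<in> L2 D" using p by auto
  have "(\<lambda>n. LINT x|lebesgue_on D. (a x *\<^sub>R g x) \<bullet> h n x) \<longlonglongrightarrow> (LINT x|lebesgue_on D. (a x *\<^sub>R g x) \<bullet> k x)"
    by (rule L2_tendsto_inner[OF ag_L2 L2n(2) L2(2) lim(2)])
  moreover have "(\<lambda>n. LINT x|lebesgue_on D. f x \<bullet> v n x) \<longlonglongrightarrow> (LINT x|lebesgue_on D. f x \<bullet> w x)"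
    by (rule L2_tendsto_inner[OF f_L2 L2n(1) L2(1) lim(1)])
  moreover have "(LINT x|lebesgue_on D. (a x *\<^sub>R g x) \<bullet> h n x) = (LINT x|lebesgue_on D. f x \<bullet> v n x)" for n
    using p[of n] by simp
  ultimately have "(LINT x|lebesgue_on D. (a x *\<^sub>R g x) \<bullet> k x) = (LINT x|lebesgue_on D. f x \<bullet> w x)"
    using LIMSEQ_unique by simp
  then show "(LINT x|lebesgue_on D. a x * (g x \<bullet> k x)) = (LINT x|lebesgue_on D. f x * w x)"
    by simp
next
  note p = pairs[unfolded admissible_pair_def]
  have L2n: "\<And>n. v n \<in> L2 D" "\<And>n. h n \<in> L2 D" using p by auto
  fix \<rho> :: real assume \<rho>: "0 < \<rho>"
  have l1: "(\<lambda>n. LINT x|lebesgue_on D. (v n x)\<^sup>2) \<longlonglongrightarrow> (LINT x|lebesgue_on D. (w x)\<^sup>2)"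
    using L2_tendsto_norm_sq[OF L2n(1) L2(1) lim(1)] by simp
  have l2: "(\<lambda>n. \<rho>\<^sup>2 / 2 * (LINT x|lebesgue_on D. (norm (h n x))\<^sup>2) +
        (LINT x|lebesgue_on D. \<bar>v n x\<bar>)\<^sup>2 / measure lborel (ball (0::'a) \<rho>)) \<longlonglongrightarrow>
      \<rho>\<^sup>2 / 2 * (LINT x|lebesgue_on D. (norm (k x))\<^sup>2) +
        (LINT x|lebesgue_on D. \<bar>w x\<bar>)\<^sup>2 / measure lborel (ball (0::'a) \<rho>)"
    using content_ball_pos[OF \<rho>, of "0::'a"]
    by (intro tendsto_intros L2_tendsto_norm_sq[OF L2n(2) L2(2) lim(2)]
        L2_tendsto_abs_integral[OF L2n(1) L2(1) lim(1)]) simp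
  show "(LINT x|lebesgue_on D. (w x)\<^sup>2) \<le> \<rho>\<^sup>2 / 2 * (LINT x|lebesgue_on D. (norm (k x))\<^sup>2) +
        (LINT x|lebesgue_on D. \<bar>w x\<bar>)\<^sup>2 / measure lborel (ball (0::'a) \<rho>)"
    by (rule LIMSEQ_le[OF l1 l2]) (use p \<rho> in blast)
qed

text \<open>Supplies the pointwise convergence for the dominated convergence argument with
  \<open>G'\<close> in \<open>admissible_pair_compose\<close>.\<close>

lemma AE_convergent_subsequence:
  obtains r where "strict_mono r" "AE x in lebesgue_on D. (\<lambda>n. \<phi> (r n) x) \<longlonglongrightarrow> u x"
proof -
  have "\<exists>r. strict_mono r \<and> (AE x in lebesgue_on D. (\<lambda>n. (\<phi> (r n) x - u x)\<^sup>2) \<longlonglongrightarrow> 0)"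
  proof (rule tendsto_L1_AE_subseq)
    show "integrable (lebesgue_on D) (\<lambda>x. (\<phi> n x - u x)\<^sup>2)" for n
      using L2D(2)[OF L2_diff[OF test_function_L2(1)[OF \<phi>_test] u_L2], of n] by simp
    show "(\<lambda>n. LINT x|lebesgue_on D. norm ((\<phi> n x - u x)\<^sup>2)) \<longlonglongrightarrow> 0"
      using \<phi>_tendsto by (simp add: L2_tendsto_def)
  qed
  then obtain r where r: "strict_mono r" "AE x in lebesgue_on D. (\<lambda>n. (\<phi> (r n) x - u x)\<^sup>2) \<longlonglongrightarrow> 0"
    by blast
  have "AE x in lebesgue_on D. (\<lambda>n. \<phi> (r n) x) \<longlonglongrightarrow> u x"
    using r(2)
  proof (rule eventually_mono)
    fix x assume "(\<lambda>n. (\<phi> (r n) x - u x)\<^sup>2) \<longlonglongrightarrow> 0"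
    then have "(\<lambda>n. sqrt ((\<phi> (r n) x - u x)\<^sup>2)) \<longlonglongrightarrow> sqrt 0" by (rule tendsto_real_sqrt)
    then have "(\<lambda>n. \<phi> (r n) x - u x) \<longlonglongrightarrow> 0" by (simp add: tendsto_rabs_zero_iff)
    then show "(\<lambda>n. \<phi> (r n) x) \<longlonglongrightarrow> u x" by (rule LIM_zero_cancel)
  qed
  with r(1) show ?thesis by (rule that)
qed

text \<open>Chain and product rule, obtained by approximating \<open>u\<close> with test functions
  while \<open>G\<close> is fixed. The hypothesis \<open>test\<close> will be met in two ways: by a
  cutoff \<open>\<zeta>\<close> with compact support, or by \<open>\<zeta>\<close> = 1 together with
  \<open>G 0 = 0\<close>.\<close>

lemma admissible_pair_compose:
  assumes G: "\<And>t. (G has_real_derivative G' t) (at t)" "continuous_on UNIV G'" "\<And>t. \<bar>G' t\<bar> \<le> 1"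
    and \<zeta>: "smooth \<zeta>" "\<And>x. \<bar>\<zeta> x\<bar> \<le> Z" "\<And>x. norm (grad \<zeta> x) \<le> Z"
    and test: "\<And>\<psi>. \<psi> \<in> test_functions D \<Longrightarrow> (\<lambda>x. \<zeta> x * G (\<psi> x)) \<in> test_functions D"
  shows "admissible_pair (\<lambda>x. \<zeta> x * G (u x)) (\<lambda>x. G (u x) *\<^sub>R grad \<zeta> x + (\<zeta> x * G' (u x)) *\<^sub>R g x)"
proof -
  have Z0: "0 \<le> Z" using \<zeta>(2)[of undefined] by linarith
  have [measurable]: "G \<in> borel_measurable borel" "G' \<in> borel_measurable borel"
    using G(1,2) by (auto intro!: borel_measurable_continuous_onI continuous_at_imp_continuous_on DERIV_isCont)
  have [measurable]: "\<zeta> \<in> borel_measurable (lebesgue_on D)" "grad \<zeta> \<in> borel_measurable (lebesgue_on D)"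
    using smooth_continuous_on[OF \<zeta>(1)] smooth_continuous_on_grad[OF \<zeta>(1)]
    by (auto intro!: continuous_imp_measurable_lebesgue_on)
  have Lip: "\<bar>G s - G t\<bar> \<le> \<bar>s - t\<bar>" for s t
    using field_differentiable_bound[of UNIV G G' 1 s t] G(1,3) by (auto simp: convex_UNIV)
  obtain r where r: "strict_mono r" "AE x in lebesgue_on D. (\<lambda>n. \<phi> (r n) x) \<longlonglongrightarrow> u x"
    by (rule AE_convergent_subsequence)
  define \<psi> where "\<psi> = (\<lambda>n. \<phi> (r n))"
  have \<psi>: "\<psi> n \<in> test_functions D" for n unfolding \<psi>_def by (rule \<phi>_test)
  have AE_lim: "AE x in lebesgue_on D. (\<lambda>n. \<psi> n x) \<longlonglongrightarrow> u x" using r(2) by (simp add: \<psi>_def)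
  have [measurable]: "\<psi> n \<in> borel_measurable (lebesgue_on D)" for n
    by (rule L2D(1)[OF test_function_L2(1)[OF \<psi>]])
  \<comment> \<open>Up to a factor, these majorize the three parts of the gradient error:
    \<open>G\<close> at the wrong argument, the wrong gradient, and \<open>G'\<close> at the wrong
    argument. The last has no Lipschitz bound, because \<open>G'\<close> is only continuous, and is
    handled by dominated convergence with majorant 2 |g|.\<close>
  define e1 where "e1 = (\<lambda>n x. (norm (\<psi> n x - u x))\<^sup>2)"
  define e2 where "e2 = (\<lambda>n x. (norm (grad (\<psi> n) x - g x))\<^sup>2)"
  define e3 where "e3 = (\<lambda>n x. (norm ((G' (\<psi> n x) - G' (u x)) *\<^sub>R g x))\<^sup>2)"
  have int1: "integrable (lebesgue_on D) (e1 n)" for n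
    unfolding e1_def by (rule L2D(2)[OF L2_diff[OF test_function_L2(1)[OF \<psi>] u_L2]])
  have int2: "integrable (lebesgue_on D) (e2 n)" for n
    unfolding e2_def by (rule L2D(2)[OF L2_diff[OF test_function_L2(2)[OF \<psi>] g_L2]])
  have lim1: "(\<lambda>n. LINT x|lebesgue_on D. e1 n x) \<longlonglongrightarrow> 0"
    using LIMSEQ_subseq_LIMSEQ[OF \<phi>_tendsto[unfolded L2_tendsto_def] r(1)]
    by (simp add: e1_def \<psi>_def o_def)
  have lim2: "(\<lambda>n. LINT x|lebesgue_on D. e2 n x) \<longlonglongrightarrow> 0"
    using LIMSEQ_subseq_LIMSEQ[OF grad_\<phi>_tendsto[unfolded L2_tendsto_def] r(1)]
    by (simp add: e2_def \<psi>_def o_def)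
  have G'_diff: "\<bar>G' s - G' t\<bar> \<le> 2" for s t
    using G(3)[of s] G(3)[of t] by linarith
  have "L2_tendsto D (\<lambda>n x. (G' (\<psi> n x) - G' (u x)) *\<^sub>R g x) (\<lambda>x. 0)"
  proof (rule L2_dominated_convergence(2)[OF L2_norm[OF L2_scaleR[OF g_L2, of 2]]])
    show "AE x in lebesgue_on D. (\<lambda>n. (G' (\<psi> n x) - G' (u x)) *\<^sub>R g x) \<longlonglongrightarrow> 0"
      using AE_lim
    proof (rule eventually_mono)
      fix x assume "(\<lambda>n. \<psi> n x) \<longlonglongrightarrow> u x"
      then have "(\<lambda>n. G' (\<psi> n x)) \<longlonglongrightarrow> G' (u x)"
        using continuous_on_tendsto_compose[OF G(2)] by simp
      then have "(\<lambda>n. (G' (\<psi> n x) - G' (u x)) *\<^sub>R g x) \<longlonglongrightarrow> (G' (u x) - G' (u x)) *\<^sub>R g x"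
        by (intro tendsto_intros)
      then show "(\<lambda>n. (G' (\<psi> n x) - G' (u x)) *\<^sub>R g x) \<longlonglongrightarrow> 0" by simp
    qed
    show "norm ((G' (\<psi> n x) - G' (u x)) *\<^sub>R g x) \<le> norm (2 *\<^sub>R g x)" for n x
      using G'_diff by (auto intro: mult_right_mono)
  qed measurable
  then have lim3: "(\<lambda>n. LINT x|lebesgue_on D. e3 n x) \<longlonglongrightarrow> 0"
    by (simp add: L2_tendsto_def e3_def)
  have int3: "integrable (lebesgue_on D) (e3 n)" for n
    unfolding e3_def
    by (rule L2D(2)[OF L2_mult_bounded[OF g_L2, of _ 2]]) (use G'_diff in auto)
  have G_L2: "(\<lambda>x. G (u x)) \<in> L2 D"
  proof (rule L2_bound[OF L2_add[OF L2_norm[OF u_L2] L2_const[of "\<bar>G 0\<bar>"]]])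
    have "\<bar>G t\<bar> \<le> \<bar>t\<bar> + \<bar>G 0\<bar>" for t using Lip[of t 0] by simp
    then show "AE x in lebesgue_on D. norm (G (u x)) \<le> norm (norm (u x) + \<bar>G 0\<bar>)" by simp
  qed measurable
  show ?thesis
  proof (rule admissible_pair_limit)
    show "admissible_pair (\<lambda>x. \<zeta> x * G (\<psi> n x)) (grad (\<lambda>x. \<zeta> x * G (\<psi> n x)))" for n
      by (intro admissible_pair_test_function test \<psi>)
    show "(\<lambda>x. \<zeta> x * G (u x)) \<in> L2 D"
      using L2_mult_bounded[OF G_L2, of \<zeta> Z] \<zeta>(2) by simp
    have "(\<lambda>x. G (u x) *\<^sub>R grad \<zeta> x) \<in> L2 D"
    proof (rule L2_bound[OF L2_scaleR[OF G_L2, of Z]])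
      show "AE x in lebesgue_on D. norm (G (u x) *\<^sub>R grad \<zeta> x) \<le> norm (Z *\<^sub>R G (u x))"
        using \<zeta>(3) Z0 by (auto simp: abs_mult mult.commute[of Z] intro!: mult_left_mono)
    qed measurable
    moreover have "(\<lambda>x. (\<zeta> x * G' (u x)) *\<^sub>R g x) \<in> L2 D"
    proof (rule L2_mult_bounded[OF g_L2, of _ Z])
      have "\<bar>\<zeta> x * G' (u x)\<bar> \<le> Z * 1" for x
        unfolding abs_mult by (rule mult_mono[OF \<zeta>(2) G(3) Z0]) simp
      then show "AE x in lebesgue_on D. \<bar>\<zeta> x * G' (u x)\<bar> \<le> Z" by simp
    qed measurable
    ultimately show "(\<lambda>x. G (u x) *\<^sub>R grad \<zeta> x + (\<zeta> x * G' (u x)) *\<^sub>R g x) \<in> L2 D"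
      by (rule L2_add)
    have bound1: "(norm ((G (\<psi> n x) - G (u x)) *\<^sub>R y))\<^sup>2 \<le> Z\<^sup>2 * e1 n x"
      if "norm y \<le> Z" for n x and y :: "'c::real_normed_vector"
    proof -
      have "norm ((G (\<psi> n x) - G (u x)) *\<^sub>R y) \<le> \<bar>\<psi> n x - u x\<bar> * Z"
        unfolding norm_scaleR by (rule mult_mono[OF Lip that]) auto
      then have "(norm ((G (\<psi> n x) - G (u x)) *\<^sub>R y))\<^sup>2 \<le> (\<bar>\<psi> n x - u x\<bar> * Z)\<^sup>2"
        by (rule power_mono) simp
      then show ?thesis by (simp add: e1_def power_mult_distrib mult.commute)
    qed
    show "L2_tendsto D (\<lambda>n x. \<zeta> x * G (\<psi> n x)) (\<lambda>x. \<zeta> x * G (u x))"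
    proof (rule L2_tendsto_squeeze)
      show "integrable (lebesgue_on D) (\<lambda>x. Z\<^sup>2 * e1 n x)" for n using int1 by simp
      show "(\<lambda>n. LINT x|lebesgue_on D. Z\<^sup>2 * e1 n x) \<longlonglongrightarrow> 0"
        using tendsto_mult_right_zero[OF lim1, of "Z\<^sup>2"] by simp
      show "(norm (\<zeta> x * G (\<psi> n x) - \<zeta> x * G (u x)))\<^sup>2 \<le> Z\<^sup>2 * e1 n x" for n x
        using bound1[of "\<zeta> x" n x] \<zeta>(2)[of x] by (simp add: algebra_simps)
    qed
    show "L2_tendsto D (\<lambda>n. grad (\<lambda>x. \<zeta> x * G (\<psi> n x))) (\<lambda>x. G (u x) *\<^sub>R grad \<zeta> x + (\<zeta> x * G' (u x)) *\<^sub>R g x)"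
    proof (rule L2_tendsto_squeeze)
      let ?e = "\<lambda>n x. 3 * (Z\<^sup>2 * e1 n x + Z\<^sup>2 * e2 n x + Z\<^sup>2 * e3 n x)"
      show "integrable (lebesgue_on D) (?e n)" for n using int1 int2 int3 by simp
      have "(\<lambda>n. 3 * (Z\<^sup>2 * (LINT x|lebesgue_on D. e1 n x) + Z\<^sup>2 * (LINT x|lebesgue_on D. e2 n x) +
          Z\<^sup>2 * (LINT x|lebesgue_on D. e3 n x))) \<longlonglongrightarrow> 3 * (Z\<^sup>2 * 0 + Z\<^sup>2 * 0 + Z\<^sup>2 * 0)"
        by (intro tendsto_intros lim1 lim2 lim3)
      then show "(\<lambda>n. LINT x|lebesgue_on D. ?e n x) \<longlonglongrightarrow> 0"
        using int1 int2 int3 by simp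
      fix n x
      have "((\<lambda>x. G (\<psi> n x)) has_derivative (\<lambda>v. (grad (\<psi> n) x \<bullet> v) * G' (\<psi> n x))) (at x)"
        by (rule DERIV_compose_FDERIV[OF G(1) smooth_has_derivative[OF test_functionsD(1)[OF \<psi>]]])
      then have "grad (\<lambda>x. \<zeta> x * G (\<psi> n x)) x = G (\<psi> n x) *\<^sub>R grad \<zeta> x + (\<zeta> x * G' (\<psi> n x)) *\<^sub>R grad (\<psi> n) x"
        by (intro grad_eqI has_derivative_eq_rhs[OF has_derivative_mult[OF smooth_has_derivative[OF \<zeta>(1)]]])
          (auto simp: inner_add_left algebra_simps)
      then have "grad (\<lambda>x. \<zeta> x * G (\<psi> n x)) x - (G (u x) *\<^sub>R grad \<zeta> x + (\<zeta> x * G' (u x)) *\<^sub>R g x) =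
          (G (\<psi> n x) - G (u x)) *\<^sub>R grad \<zeta> x + (\<zeta> x * G' (\<psi> n x)) *\<^sub>R (grad (\<psi> n) x - g x) +
          \<zeta> x *\<^sub>R ((G' (\<psi> n x) - G' (u x)) *\<^sub>R g x)" (is "?d = ?x + ?y + ?z")
        by (simp add: algebra_simps)
      then have "(norm ?d)\<^sup>2 \<le> 3 * ((norm ?x)\<^sup>2 + (norm ?y)\<^sup>2 + (norm ?z)\<^sup>2)"
        by (simp only: norm_sum3_sq)
      also have "\<dots> \<le> ?e n x"
      proof (intro mult_left_mono add_mono)
        show "(norm ?x)\<^sup>2 \<le> Z\<^sup>2 * e1 n x" by (rule bound1[OF \<zeta>(3)])
        have \<zeta>sq: "(\<zeta> x)\<^sup>2 \<le> Z\<^sup>2" using power_mono[OF \<zeta>(2)[of x], of 2] by simp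
        have "(G' (\<psi> n x))\<^sup>2 \<le> 1" using power_mono[OF G(3)[of "\<psi> n x"], of 2] by simp
        with \<zeta>sq have "(\<zeta> x)\<^sup>2 * (G' (\<psi> n x))\<^sup>2 \<le> Z\<^sup>2 * 1" by (rule mult_mono) auto
        then show "(norm ?y)\<^sup>2 \<le> Z\<^sup>2 * e2 n x"
          by (simp add: e2_def power_mult_distrib mult_right_mono)
        show "(norm ?z)\<^sup>2 \<le> Z\<^sup>2 * e3 n x"
          unfolding norm_scaleR[of "\<zeta> x"] power_mult_distrib e3_def using \<zeta>sq by (simp add: mult_right_mono)
      qed simp
      finally show "(norm ?d)\<^sup>2 \<le> ?e n x" .
    qed
  qed
qed

end

section \<open>Truncations of the solution\<close>

text \<open>The value 1/2 at 0 is the limit of \<open>sigmoid\<close> along multiples of 0. With it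
  the derivatives converge at every point, also where u = k, and no separate information about
  \<open>g\<close> on that level set is called for.\<close>

definition heaviside :: "real \<Rightarrow> real" where
  "heaviside s = (if s > 0 then 1 else if s = 0 then 1 / 2 else 0)"

lemma heaviside_bounds: "0 \<le> heaviside s" "heaviside s \<le> 1"
  by (auto simp: heaviside_def)

lemma max_rescale: "max (real (Suc n) * s) 0 = real (Suc n) * max s 0"
  by (simp add: max_def mult_le_0_iff zero_le_mult_iff)

lemma softplus_rescaled_tendsto: "(\<lambda>n. softplus (real (Suc n) * s) / real (Suc n)) \<longlonglongrightarrow> max s 0"
proof (rule tendsto_sandwich[OF always_eventually always_eventually tendsto_const])
  show "\<forall>n. max s 0 \<le> softplus (real (Suc n) * s) / real (Suc n)"
  proof
    fix n
    show "max s 0 \<le> softplus (real (Suc n) * s) / real (Suc n)"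
      using softplus_bounds(1)[of "real (Suc n) * s"] unfolding max_rescale
      by (simp only: pos_le_divide_eq of_nat_0_less_iff zero_less_Suc mult.commute)
  qed
  show "\<forall>n. softplus (real (Suc n) * s) / real (Suc n) \<le> max s 0 + ln 2 * inverse (real (Suc n))"
  proof
    fix n
    have "softplus (real (Suc n) * s) \<le> (max s 0 + ln 2 * inverse (real (Suc n))) * real (Suc n)"
      using softplus_bounds(2)[of "real (Suc n) * s"] unfolding max_rescale
      by (simp add: distrib_right mult.commute[of "real (Suc n)"] del: of_nat_Suc flip: divide_inverse)
    then show "softplus (real (Suc n) * s) / real (Suc n) \<le> max s 0 + ln 2 * inverse (real (Suc n))"
      by (simp only: pos_divide_le_eq of_nat_0_less_iff zero_less_Suc)
  qed
  have "(\<lambda>n. max s 0 + ln 2 * inverse (real (Suc n))) \<longlonglongrightarrow> max s 0 + ln 2 * 0"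
    by (intro tendsto_intros LIMSEQ_inverse_real_of_nat)
  then show "(\<lambda>n. max s 0 + ln 2 * inverse (real (Suc n))) \<longlonglongrightarrow> max s 0" by simp
qed

lemma sigmoid_rescaled_tendsto: "(\<lambda>n. sigmoid (real (Suc n) * s)) \<longlonglongrightarrow> heaviside s"
proof -
  have e: "exp (real (Suc n) * t) = exp t ^ Suc n" for n t
    by (metis exp_of_nat_mult)
  consider "s > 0" | "s = 0" | "s < 0" by linarith
  then show ?thesis
  proof cases
    case 1
    have "(\<lambda>n. 1 / (1 + exp (- s) ^ Suc n)) \<longlonglongrightarrow> 1 / (1 + 0)"
      using 1 by (intro tendsto_intros LIMSEQ_Suc[OF LIMSEQ_power_zero]) auto
    moreover have "sigmoid t = 1 / (1 + exp (- t))" for t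
      using exp_gt_zero[of t] by (simp add: sigmoid_def exp_minus divide_simps add_pos_pos)
    then have "sigmoid (real (Suc n) * s) = 1 / (1 + exp (- s) ^ Suc n)" for n
      using e[of n "- s"] by simp
    ultimately show ?thesis using 1 by (simp add: heaviside_def)
  next
    case 2
    then show ?thesis by (simp add: heaviside_def sigmoid_def)
  next
    case 3
    have "(\<lambda>n. exp s ^ Suc n / (1 + exp s ^ Suc n)) \<longlonglongrightarrow> 0 / (1 + 0)"
      using 3 by (intro tendsto_intros LIMSEQ_Suc[OF LIMSEQ_power_zero]) auto
    then show ?thesis using 3 unfolding sigmoid_def e by (simp add: heaviside_def)
  qed
qed

lemma smooth_softplus_rescaled:
  assumes "smooth \<psi>"
  shows "smooth (\<lambda>x. softplus (c * (k - \<psi> x)) / c - b)"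
proof -
  obtain G where G: "derivative_sequence G" "G 0 = softplus"
    by (rule softplus_derivative_sequence)
  have "smooth (\<lambda>x. G 0 (c * (k - \<psi> x)))"
    by (intro smooth_compose[OF G(1)] smooth_mult smooth_diff smooth_const assms)
  then have "smooth (\<lambda>x. (1 / c) * softplus (c * (k - \<psi> x)) - b)"
    unfolding G(2) by (intro smooth_mult smooth_diff smooth_const)
  then show ?thesis by simp
qed

section \<open>Cutoff functions and the abstract recursion\<close>

lemma test_function_bounded:
  assumes "\<psi> \<in> test_functions D"
  obtains Z where "\<And>x. \<bar>\<psi> x\<bar> \<le> Z" "\<And>x. norm (grad \<psi> x) \<le> Z"
proof -
  obtain K where K: "compact K" "K \<subseteq> D" "\<And>x. x \<notin> K \<Longrightarrow> \<psi> x = 0" "\<And>x. x \<notin> K \<Longrightarrow> grad \<psi> x = 0"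
    using test_functionsE[OF assms] by blast
  have "bounded (\<psi> ` K)" "bounded (grad \<psi> ` K)"
    using K(1) test_functionsD(2,3)[OF assms]
    by (auto intro!: compact_imp_bounded compact_continuous_image)
  then obtain B1 B2 where B: "\<And>x. x \<in> K \<Longrightarrow> norm (\<psi> x) \<le> B1" "\<And>x. x \<in> K \<Longrightarrow> norm (grad \<psi> x) \<le> B2"
    unfolding bounded_iff by auto
  show ?thesis
  proof (rule that[of "max (max B1 B2) 0"])
    show "\<bar>\<psi> x\<bar> \<le> max (max B1 B2) 0" for x
      using B(1)[of x] K(3)[of x] by (cases "x \<in> K") auto
    show "norm (grad \<psi> x) \<le> max (max B1 B2) 0" for x
      using B(2)[of x] K(4)[of x] by (cases "x \<in> K") auto
  qed
qed

text \<open>The bump is applied to a quadratic \<open>q\<close> that is at most 0 outside the larger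
  ball and at least 1 on the smaller one. There is no plateau: the lower bound exp(-1) costs only a
  constant factor later. As c = 1 / ((r - r') (r + r')), the bound |x - z| \<le> r + r' leaves 2 /
  (r - r') for the gradient.\<close>

lemma bump_cutoff:
  fixes z :: "'a::euclidean_space"
  assumes r: "0 < r'" "r' < r" and D: "cball z r \<subseteq> D"
  obtains \<eta> where "\<eta> \<in> test_functions D" "\<And>x. 0 \<le> \<eta> x" "\<And>x. \<eta> x \<le> 1"
    "\<And>x. x \<in> ball z r' \<Longrightarrow> exp (-1) \<le> \<eta> x"
    "\<And>x. norm (grad \<eta> x) \<le> 2 / (r - r')" "\<And>x. x \<notin> ball z r \<Longrightarrow> grad \<eta> x = 0"
proof -
  define c where "c = 1 / (r\<^sup>2 - r'\<^sup>2)"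
  have c_eq: "r\<^sup>2 - r'\<^sup>2 = (r - r') * (r + r')" by (simp add: power2_eq_square algebra_simps)
  have c: "0 < c" unfolding c_def c_eq using r by simp
  define q where "q = (\<lambda>x. c * (r\<^sup>2 - (norm (x - z))\<^sup>2))"
  define \<eta> where "\<eta> = (\<lambda>x. bump (q x))"
  obtain G where G: "derivative_sequence G" "G 0 = bump" "G 1 = bump_deriv"
    by (rule bump_derivative_sequence)
  have q: "smooth q"
    unfolding q_def by (intro smooth_mult smooth_diff smooth_const smooth_norm_diff_sq)
  have smooth: "smooth \<eta>"
    unfolding \<eta>_def G(2)[symmetric] by (rule smooth_compose[OF G(1) q])
  have grad_q: "grad q x = (- 2 * c) *\<^sub>R (x - z)" for x
    unfolding q_def power2_norm_eq_inner
    by (rule grad_eqI) (auto intro!: derivative_eq_intros simp: inner_commute algebra_simps)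
  have grad: "grad \<eta> x = bump_deriv (q x) *\<^sub>R (- 2 * c) *\<^sub>R (x - z)" for x
    unfolding \<eta>_def grad_q[symmetric] by (rule grad_compose[OF bump_has_derivative q])
  have q_out: "q x \<le> 0" if "x \<notin> ball z r" for x
  proof -
    have "r\<^sup>2 \<le> (norm (x - z))\<^sup>2"
      using that r by (intro power_mono) (auto simp: dist_norm norm_minus_commute)
    then show ?thesis using c by (simp add: q_def mult_le_0_iff)
  qed
  show ?thesis
  proof (rule that)
    show "\<eta> \<in> test_functions D"
    proof (rule test_functionsI[OF smooth compact_cball D])
      fix x assume "x \<notin> cball z r"
      then have "q x \<le> 0" by (intro q_out) auto
      then show "\<eta> x = 0" by (simp add: \<eta>_def bump_def)
    qed
    show "0 \<le> \<eta> x" "\<eta> x \<le> 1" for x by (simp_all add: \<eta>_def bump_nonneg bump_le_1)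
    show "exp (-1) \<le> \<eta> x" if "x \<in> ball z r'" for x
    proof -
      have "(norm (x - z))\<^sup>2 \<le> r'\<^sup>2"
        using that by (intro power_mono) (auto simp: dist_norm norm_minus_commute)
      then have "c * (r\<^sup>2 - r'\<^sup>2) \<le> q x" using c by (simp add: q_def)
      then have "1 \<le> q x" using c by (simp add: c_def split: if_splits)
      then show ?thesis unfolding \<eta>_def by (rule bump_ge)
    qed
    show out: "grad \<eta> x = 0" if "x \<notin> ball z r" for x
      using q_out[OF that] by (simp add: grad bump_deriv_def)
    show "norm (grad \<eta> x) \<le> 2 / (r - r')" for x
    proof (cases "x \<in> ball z r")
      case True
      have "norm (grad \<eta> x) = \<bar>bump_deriv (q x)\<bar> * (2 * c * norm (x - z))"
        using c by (simp add: grad abs_mult)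
      also have "\<dots> \<le> 1 * (2 * c * (r + r'))"
        using True r c by (intro mult_mono bump_deriv_bound) (auto simp: dist_norm norm_minus_commute)
      also have "\<dots> = 2 * (c * (r + r'))" by simp
      also have "c * (r + r') = 1 / (r - r')"
        unfolding c_def c_eq using r by (simp add: nonzero_divide_mult_cancel_right)
      finally show ?thesis by simp
    qed (use out r in auto)
  qed
qed

text \<open>Induction with a geometric majorant of ratio 1/\<beta>. The linear term uses up half of
  the allowed value; in the quadratic one, \<beta>^j (V / \<beta>^j)^2 is V times the majorant, and
  the smallness of C V makes it the other half.\<close>

lemma superlinear_decay:
  fixes X :: "nat \<Rightarrow> real"
  assumes "1 \<le> \<beta>" "0 \<le> C" "0 \<le> V" "C * V \<le> 1 / (2 * \<beta>)" "X 0 \<le> V" "\<And>j. 0 \<le> X j"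
    and step: "\<And>j. X (Suc j) \<le> X j / (2 * \<beta>) + C * \<beta> ^ j * (X j)\<^sup>2"
  shows "X j \<le> V / \<beta> ^ j"
proof (induction j)
  case (Suc j)
  have \<beta>: "0 < \<beta> ^ j" using assms(1) by simp
  have "X (Suc j) \<le> (V / \<beta> ^ j) / (2 * \<beta>) + C * \<beta> ^ j * (V / \<beta> ^ j)\<^sup>2"
    using Suc assms
    by (intro order_trans[OF step] add_mono divide_right_mono mult_left_mono power_mono) auto
  also have "\<dots> = (V / \<beta> ^ j) * (1 / (2 * \<beta>) + C * V)"
    using \<beta> assms(1) by (simp add: power2_eq_square field_simps)
  also have "\<dots> \<le> (V / \<beta> ^ j) * (1 / (2 * \<beta>) + 1 / (2 * \<beta>))"
    using assms(3,4) \<beta> by (intro mult_left_mono) auto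
  also have "\<dots> = V / \<beta> ^ Suc j" using assms(1) by simp
  finally show ?case .
qed (use assms in simp)

section \<open>The truncation as a limit of test functions, and its energy estimate\<close>

context weak_problem
begin

text \<open>The second of two successive limits: now \<open>u\<close> is fixed and smooth
  \<open>G n\<close> approach a function \<open>H\<close> that may have a kink, where
  \<open>H'\<close> is just the pointwise limit of the derivatives. Dominated convergence applies
  because of the uniform linear growth.\<close>

lemma admissible_pair_pointwise_limit:
  assumes pairs: "\<And>n. admissible_pair (\<lambda>x. \<zeta> x * G n (u x))
      (\<lambda>x. G n (u x) *\<^sub>R grad \<zeta> x + (\<zeta> x * G' n (u x)) *\<^sub>R g x)"
    and lim: "\<And>t. (\<lambda>n. G n t) \<longlonglongrightarrow> H t" "\<And>t. (\<lambda>n. G' n t) \<longlonglongrightarrow> H' t"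
    and bounds: "\<And>n t. \<bar>G n t\<bar> \<le> C + \<bar>t\<bar>" "\<And>n t. \<bar>G' n t\<bar> \<le> 1"
    and \<zeta>: "smooth \<zeta>" "\<And>x. \<bar>\<zeta> x\<bar> \<le> Z" "\<And>x. norm (grad \<zeta> x) \<le> Z"
    and [measurable]: "H \<in> borel_measurable borel" "H' \<in> borel_measurable borel"
  shows "admissible_pair (\<lambda>x. \<zeta> x * H (u x)) (\<lambda>x. H (u x) *\<^sub>R grad \<zeta> x + (\<zeta> x * H' (u x)) *\<^sub>R g x)"
proof -
  note p = pairs[unfolded admissible_pair_def]
  have Z0: "0 \<le> Z" using \<zeta>(2)[of undefined] by linarith
  have [measurable]: "\<zeta> \<in> borel_measurable (lebesgue_on D)" "grad \<zeta> \<in> borel_measurable (lebesgue_on D)"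
    using smooth_continuous_on[OF \<zeta>(1)] smooth_continuous_on_grad[OF \<zeta>(1)]
    by (auto intro!: continuous_imp_measurable_lebesgue_on)
  have W1: "(\<lambda>x. Z * (C + \<bar>u x\<bar>)) \<in> L2 D"
    using L2_scaleR[OF L2_add[OF L2_const[of C] L2_norm[OF u_L2]], of Z] by simp
  have W2: "(\<lambda>x. Z * (C + \<bar>u x\<bar>) + Z * norm (g x)) \<in> L2 D"
    using L2_add[OF W1 L2_scaleR[OF L2_norm[OF g_L2], of Z]] by simp
  have Cu: "0 \<le> C + \<bar>u x\<bar>" for x using bounds(1)[of 0 "u x"] by linarith
  have lv: "AE x in lebesgue_on D. (\<lambda>n. \<zeta> x * G n (u x)) \<longlonglongrightarrow> \<zeta> x * H (u x)"
    by (intro AE_I2 tendsto_intros lim)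
  have bv: "norm (\<zeta> x * G n (u x)) \<le> Z * (C + \<bar>u x\<bar>)" for n x
    unfolding real_norm_def abs_mult by (intro mult_mono \<zeta> bounds Z0) simp
  have lh: "AE x in lebesgue_on D. (\<lambda>n. G n (u x) *\<^sub>R grad \<zeta> x + (\<zeta> x * G' n (u x)) *\<^sub>R g x)
      \<longlonglongrightarrow> H (u x) *\<^sub>R grad \<zeta> x + (\<zeta> x * H' (u x)) *\<^sub>R g x"
    by (intro AE_I2 tendsto_intros lim)
  have bh: "norm (G n (u x) *\<^sub>R grad \<zeta> x + (\<zeta> x * G' n (u x)) *\<^sub>R g x) \<le> Z * (C + \<bar>u x\<bar>) + Z * norm (g x)" for n x
  proof (rule order_trans[OF norm_triangle_ineq add_mono])
    show "norm (G n (u x) *\<^sub>R grad \<zeta> x) \<le> Z * (C + \<bar>u x\<bar>)"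
      unfolding norm_scaleR mult.commute[of Z] by (intro mult_mono \<zeta> bounds Cu) simp
    have "\<bar>\<zeta> x * G' n (u x)\<bar> \<le> Z * 1"
      unfolding abs_mult by (intro mult_mono \<zeta> bounds Z0) simp
    then show "norm ((\<zeta> x * G' n (u x)) *\<^sub>R g x) \<le> Z * norm (g x)"
      unfolding norm_scaleR by (intro mult_right_mono) auto
  qed
  have mv: "(\<lambda>x. \<zeta> x * G n (u x)) \<in> borel_measurable (lebesgue_on D)" for n
    by (rule L2D(1)[OF p[THEN conjunct1]])
  have mh: "(\<lambda>x. G n (u x) *\<^sub>R grad \<zeta> x + (\<zeta> x * G' n (u x)) *\<^sub>R g x) \<in> borel_measurable (lebesgue_on D)" for n
    by (rule L2D(1)[OF p[THEN conjunct2, THEN conjunct1]])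
  have mv': "(\<lambda>x. \<zeta> x * H (u x)) \<in> borel_measurable (lebesgue_on D)" by measurable
  have mh': "(\<lambda>x. H (u x) *\<^sub>R grad \<zeta> x + (\<zeta> x * H' (u x)) *\<^sub>R g x) \<in> borel_measurable (lebesgue_on D)"
    by measurable
  note dv = L2_dominated_convergence[OF W1 mv mv' lv bv]
  note dh = L2_dominated_convergence[OF W2 mh mh' lh bh]
  show ?thesis by (rule admissible_pair_limit[OF pairs dv(1) dh(1) dv(2) dh(2)])
qed

text \<open>The offsets \<open>b n\<close> leave the limit unchanged and allow the approximations to
  be normalized to 0 at 0 when \<open>\<zeta>\<close> does not provide compact support.\<close>

lemma admissible_pair_truncation:
  assumes \<zeta>: "smooth \<zeta>" "\<And>x. \<bar>\<zeta> x\<bar> \<le> Z" "\<And>x. norm (grad \<zeta> x) \<le> Z"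
    and b: "b \<longlonglongrightarrow> 0" "\<And>n. \<bar>b n\<bar> \<le> 1"
    and test: "\<And>n \<psi>. \<psi> \<in> test_functions D \<Longrightarrow>
      (\<lambda>x. \<zeta> x * (softplus (real (Suc n) * (k - \<psi> x)) / real (Suc n) - b n)) \<in> test_functions D"
  shows "admissible_pair (\<lambda>x. \<zeta> x * max (k - u x) 0)
    (\<lambda>x. max (k - u x) 0 *\<^sub>R grad \<zeta> x + (\<zeta> x * - heaviside (k - u x)) *\<^sub>R g x)"
proof (rule admissible_pair_pointwise_limit[OF _ _ _ _ _ \<zeta>,
    where G = "\<lambda>n t. softplus (real (Suc n) * (k - t)) / real (Suc n) - b n"
      and G' = "\<lambda>n t. - sigmoid (real (Suc n) * (k - t))" and C = "\<bar>k\<bar> + 2"])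
  have s: "\<bar>- sigmoid t\<bar> \<le> 1" for t using sigmoid_bounds[of t] by simp
  then show "\<bar>- sigmoid (real (Suc n) * (k - t))\<bar> \<le> 1" for n t .
  show "admissible_pair (\<lambda>x. \<zeta> x * (softplus (real (Suc n) * (k - u x)) / real (Suc n) - b n))
      (\<lambda>x. (softplus (real (Suc n) * (k - u x)) / real (Suc n) - b n) *\<^sub>R grad \<zeta> x +
        (\<zeta> x * - sigmoid (real (Suc n) * (k - u x))) *\<^sub>R g x)" for n
  proof (rule admissible_pair_compose[OF _ _ s \<zeta> test])
    show "((\<lambda>t. softplus (real (Suc n) * (k - t)) / real (Suc n) - b n) has_real_derivative
        - sigmoid (real (Suc n) * (k - t))) (at t)" for t
      by (rule derivative_eq_intros DERIV_chain2[OF softplus_has_derivative] refl | simp add: divide_simps del: of_nat_Suc)+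
    have c: "continuous_on UNIV sigmoid"
      by (intro continuous_at_imp_continuous_on ballI DERIV_isCont[OF sigmoid_has_derivative])
    show "continuous_on UNIV (\<lambda>t. - sigmoid (real (Suc n) * (k - t)))"
      by (rule continuous_on_minus, rule continuous_on_compose2[OF c]) (auto intro!: continuous_intros simp del: of_nat_Suc)
  qed
  have "(\<lambda>n. softplus (real (Suc n) * (k - t)) / real (Suc n) - b n) \<longlonglongrightarrow> max (k - t) 0 - 0" for t
    by (intro tendsto_intros softplus_rescaled_tendsto b)
  then show "(\<lambda>n. softplus (real (Suc n) * (k - t)) / real (Suc n) - b n) \<longlonglongrightarrow> max (k - t) 0" for t by simp
  show "(\<lambda>n. - sigmoid (real (Suc n) * (k - t))) \<longlonglongrightarrow> - heaviside (k - t)" for t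
    by (intro tendsto_intros sigmoid_rescaled_tendsto)
  \<comment> \<open>Here max (k - t) 0 \<le> |k| + |t|, and the 2 pays for the softplus error, at
    most ln 2, and for the offset, at most 1.\<close>
  show "\<bar>softplus (real (Suc n) * (k - t)) / real (Suc n) - b n\<bar> \<le> \<bar>k\<bar> + 2 + \<bar>t\<bar>" for n t
  proof -
    have "softplus (real (Suc n) * (k - t)) \<le> real (Suc n) * max (k - t) 0 + ln 2"
      using softplus_bounds(2)[of "real (Suc n) * (k - t)"]
      unfolding max_rescale .
    also have "\<dots> \<le> real (Suc n) * (max (k - t) 0 + 1)"
      using ln_2_less_1 by (simp add: distrib_left)
    finally have "softplus (real (Suc n) * (k - t)) / real (Suc n) \<le> max (k - t) 0 + 1"
      by (simp add: pos_divide_le_eq mult.commute del: of_nat_Suc)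
    moreover have "0 \<le> softplus (real (Suc n) * (k - t)) / real (Suc n)"
      using softplus_bounds(1)[of "real (Suc n) * (k - t)"] by simp
    ultimately show ?thesis using b(2)[of n] by linarith
  qed
  show "(\<lambda>t. max (k - t) 0) \<in> borel_measurable borel" by measurable
  show "(\<lambda>t. - heaviside (k - t)) \<in> borel_measurable borel" unfolding heaviside_def by measurable
qed

lemma f_pos: "AE x in lebesgue_on D. 0 < f x"
  using f_bound by (rule eventually_mono) (use c_f_pos in auto)

text \<open>Testing with the negative part of \<open>u\<close> makes the left side of the equation
  at most 0 and the right side at least 0. Hence \<open>f\<close> times the negative part vanishes
  almost everywhere, and \<open>f\<close> is positive.\<close>

lemma solution_nonneg: "AE x in lebesgue_on D. 0 \<le> u x"
proof -
  let ?v = "\<lambda>x. max (0 - u x) 0" and ?\<theta> = "\<lambda>x. heaviside (0 - u x)"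
  have "admissible_pair (\<lambda>x. 1 * ?v x) (\<lambda>x. ?v x *\<^sub>R grad (\<lambda>x. 1) x + (1 * - ?\<theta> x) *\<^sub>R g x)"
  proof (rule admissible_pair_truncation[where Z = 1 and b = "\<lambda>n. ln 2 * inverse (real (Suc n))"])
    \<comment> \<open>This offset is the value of the rescaled softplus at 0; after subtracting it
      the composite vanishes wherever \<open>\<psi>\<close> does, so compact support survives with
      \<open>\<zeta>\<close> = 1.\<close>
    show "(\<lambda>n. ln 2 * inverse (real (Suc n))) \<longlonglongrightarrow> 0"
      using tendsto_mult_right_zero[OF LIMSEQ_inverse_real_of_nat] by simp
    show "\<bar>ln 2 * inverse (real (Suc n))\<bar> \<le> 1" for n
      using ln_2_less_1 by (simp add: field_simps)
    fix n and \<psi> :: "'a \<Rightarrow> real" assume \<psi>: "\<psi> \<in> test_functions D"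
    obtain K where K: "compact K" "K \<subseteq> D" "\<And>x. x \<notin> K \<Longrightarrow> \<psi> x = 0" "\<And>x. x \<notin> K \<Longrightarrow> grad \<psi> x = 0"
      using test_functionsE[OF \<psi>] by blast
    show "(\<lambda>x. 1 * (softplus (real (Suc n) * (0 - \<psi> x)) / real (Suc n) - ln 2 * inverse (real (Suc n)))) \<in> test_functions D"
      by (rule test_functionsI[OF smooth_mult[OF smooth_const smooth_softplus_rescaled[OF test_functionsD(1)[OF \<psi>]]] K(1,2)])
        (simp add: K(3) softplus_def divide_inverse)
  qed simp_all
  then have v_L2: "?v \<in> L2 D"
    and eq: "(LINT x|lebesgue_on D. a x * (g x \<bullet> (- ?\<theta> x *\<^sub>R g x))) = (LINT x|lebesgue_on D. f x * ?v x)"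
    by (simp_all add: admissible_pair_def)
  have "(LINT x|lebesgue_on D. - (a x * ?\<theta> x * (g x \<bullet> g x))) \<le> 0"
  proof -
    have "0 \<le> (LINT x|lebesgue_on D. a x * ?\<theta> x * (g x \<bullet> g x))"
      by (rule integral_nonneg_AE, rule eventually_mono[OF a_bounds])
        (use lam_pos heaviside_bounds in auto)
    then show ?thesis by simp
  qed
  then have le0: "(LINT x|lebesgue_on D. f x * ?v x) \<le> 0"
    unfolding eq[symmetric] by (simp add: mult.assoc)
  have nn: "AE x in lebesgue_on D. 0 \<le> f x * ?v x"
    by (rule eventually_mono[OF f_pos]) simp
  have int: "integrable (lebesgue_on D) (\<lambda>x. f x * ?v x)"
    using L2_inner_integrable[OF f_L2 v_L2] by simp
  have "(LINT x|lebesgue_on D. f x * ?v x) = 0"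
    using le0 integral_nonneg_AE[OF nn] by simp
  then have "AE x in lebesgue_on D. f x * ?v x = 0"
    using integral_nonneg_eq_0_iff_AE[OF int nn] by simp
  then show ?thesis using f_pos
    by eventually_elim (auto simp: max_def split: if_splits)
qed

lemma truncation_L2: "(\<lambda>x. max (k - u x) 0) \<in> L2 D"
proof (rule L2_bound[OF L2_add[OF L2_const[of "\<bar>k\<bar>"] L2_norm[OF u_L2]]])
  show "AE x in lebesgue_on D. norm (max (k - u x) 0) \<le> norm (\<bar>k\<bar> + norm (u x))" by auto
qed measurable

text \<open>The term \<open>f\<close> makes the integral of the truncation itself quadratically small,
  so that Nash's inequality gains a power without changing the level \<open>k\<close>.\<close>

lemma truncation_energy:
  assumes \<eta>: "\<eta> \<in> test_functions D" "\<And>x. 0 \<le> \<eta> x" "\<And>x. \<eta> x \<le> 1" and \<rho>: "0 < \<rho>"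
    and E_def: "E = (LINT x|lebesgue_on D. (norm (max (k - u x) 0 *\<^sub>R grad \<eta> x))\<^sup>2)"
  shows "(LINT x|lebesgue_on D. ((\<eta> x)\<^sup>2 * max (k - u x) 0)\<^sup>2) \<le>
    \<rho>\<^sup>2 / 2 * ((8 + 8 * Lam / lam) * E) + (2 * Lam / c_f * E)\<^sup>2 / measure lborel (ball (0::'a) \<rho>)"
proof -
  define W where "W = (\<lambda>x. max (k - u x) 0)"
  define \<theta> where "\<theta> = (\<lambda>x. heaviside (k - u x))"
  \<comment> \<open>Squaring gives \<open>grad \<zeta>\<close> a factor \<open>\<eta>\<close>, which
    pairs with \<open>g\<close> in the absorption below.\<close>
  define \<zeta> where "\<zeta> = (\<lambda>x. \<eta> x * \<eta> x)"
  define h where "h = (\<lambda>x. W x *\<^sub>R grad \<zeta> x + (\<zeta> x * - \<theta> x) *\<^sub>R g x)"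
  define P where "P = (\<lambda>x. \<zeta> x * \<theta> x * (norm (g x))\<^sup>2)"
  define S where "S = (\<lambda>x. (norm (W x *\<^sub>R grad \<eta> x))\<^sup>2)"
  have E: "E = (LINT x|lebesgue_on D. S x)" by (simp add: E_def S_def W_def)
  have \<zeta>: "\<zeta> \<in> test_functions D"
    unfolding \<zeta>_def by (rule test_functions_mult[OF \<eta>(1) test_functionsD(1)[OF \<eta>(1)]])
  have grad_\<zeta>: "grad \<zeta> x = (2 * \<eta> x) *\<^sub>R grad \<eta> x" for x
    unfolding \<zeta>_def grad_mult[OF test_functionsD(1)[OF \<eta>(1)] test_functionsD(1)[OF \<eta>(1)]]
    by (simp flip: scaleR_left_distrib)
  obtain Z where Z: "\<And>x. \<bar>\<zeta> x\<bar> \<le> Z" "\<And>x. norm (grad \<zeta> x) \<le> Z"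
    using test_function_bounded[OF \<zeta>] by blast
  obtain Y where Y: "\<And>x. \<bar>\<eta> x\<bar> \<le> Y" "\<And>x. norm (grad \<eta> x) \<le> Y"
    using test_function_bounded[OF \<eta>(1)] by blast
  have "admissible_pair (\<lambda>x. \<zeta> x * W x) h"
    unfolding W_def h_def \<theta>_def
  proof (rule admissible_pair_truncation[OF test_functionsD(1)[OF \<zeta>] Z tendsto_const])
    fix n and \<psi> :: "'a \<Rightarrow> real" assume "\<psi> \<in> test_functions D"
    then show "(\<lambda>x. \<zeta> x * (softplus (real (Suc n) * (k - \<psi> x)) / real (Suc n) - 0)) \<in> test_functions D"
      by (intro test_functions_mult[OF \<zeta>] smooth_softplus_rescaled test_functionsD(1))
  qed simp
  then have v_L2: "(\<lambda>x. \<zeta> x * W x) \<in> L2 D" and h_L2: "h \<in> L2 D"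
    and eq: "(LINT x|lebesgue_on D. a x * (g x \<bullet> h x)) = (LINT x|lebesgue_on D. f x * (\<zeta> x * W x))"
    and Nash: "(LINT x|lebesgue_on D. (\<zeta> x * W x)\<^sup>2) \<le> \<rho>\<^sup>2 / 2 * (LINT x|lebesgue_on D. (norm (h x))\<^sup>2) +
        (LINT x|lebesgue_on D. \<bar>\<zeta> x * W x\<bar>)\<^sup>2 / measure lborel (ball (0::'a) \<rho>)"
    using \<rho> by (auto simp: admissible_pair_def)
  have W0: "0 \<le> W x" for x by (simp add: W_def)
  have \<zeta>01: "0 \<le> \<zeta> x" "\<zeta> x \<le> 1" for x
    using \<eta>(2,3)[of x] by (auto simp: \<zeta>_def mult_le_one)
  have \<theta>01: "0 \<le> \<theta> x" "\<theta> x \<le> 1" for x by (simp_all add: \<theta>_def heaviside_bounds)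
  have [measurable]: "W \<in> borel_measurable (lebesgue_on D)" "\<theta> \<in> borel_measurable (lebesgue_on D)"
    unfolding W_def \<theta>_def heaviside_def by measurable
  have [measurable]: "\<zeta> \<in> borel_measurable (lebesgue_on D)" "grad \<eta> \<in> borel_measurable (lebesgue_on D)"
    by (rule L2D(1)[OF test_function_L2(1)[OF \<zeta>]], rule L2D(1)[OF test_function_L2(2)[OF \<eta>(1)]])
  have W_L2: "W \<in> L2 D"
    unfolding W_def by (rule truncation_L2)
  have int_S: "integrable (lebesgue_on D) S"
  proof -
    have "(\<lambda>x. W x *\<^sub>R grad \<eta> x) \<in> L2 D"
    proof (rule L2_bound[OF L2_scaleR[OF W_L2, of Y]])
      have "norm (W x *\<^sub>R grad \<eta> x) \<le> norm (Y *\<^sub>R W x)" for x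
        using mult_right_mono[OF order_trans[OF Y(2)[of x] abs_ge_self] W0[of x]] W0[of x]
        by (simp add: abs_mult mult.commute)
      then show "AE x in lebesgue_on D. norm (W x *\<^sub>R grad \<eta> x) \<le> norm (Y *\<^sub>R W x)" by simp
    qed measurable
    then show ?thesis unfolding S_def by (rule L2D(2))
  qed
  have int_P: "integrable (lebesgue_on D) P"
  proof -
    have "(\<lambda>x. (\<zeta> x * \<theta> x) *\<^sub>R g x) \<in> L2 D"
      by (rule L2_mult_bounded[OF g_L2, of _ 1]) (use \<zeta>01 \<theta>01 in \<open>auto simp: abs_mult intro!: mult_le_one\<close>)
    from L2_inner_integrable[OF this g_L2] show ?thesis by (simp add: P_def power2_norm_eq_inner)
  qed
  have int_v: "integrable (lebesgue_on D) (\<lambda>x. \<zeta> x * W x)" by (rule L2_integrable[OF v_L2])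
  have int_fv: "integrable (lebesgue_on D) (\<lambda>x. f x * (\<zeta> x * W x))"
    using L2_inner_integrable[OF f_L2 v_L2] by simp
  have int_agh: "integrable (lebesgue_on D) (\<lambda>x. a x * (g x \<bullet> h x))"
    using L2_inner_integrable[OF ag_L2 h_L2] by simp
  \<comment> \<open>Young's inequality, from the square of \<eta> g - 2 W grad \<eta>. Where W = 0,
    only -P remains, which is at most -P/2; where W > 0, \<open>\<theta>\<close> is 1.\<close>
  have absorb: "g x \<bullet> h x \<le> - (P x) / 2 + 2 * S x" for x
  proof (cases "W x = 0")
    case True
    then show ?thesis using \<zeta>01[of x] \<theta>01[of x]
      by (simp add: h_def P_def S_def power2_norm_eq_inner)
  next
    case False
    then have \<theta>: "\<theta> x = 1" by (auto simp: W_def \<theta>_def heaviside_def max_def split: if_splits)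
    have "0 \<le> (norm (\<eta> x *\<^sub>R g x - (2 * W x) *\<^sub>R grad \<eta> x))\<^sup>2" by simp
    also have "\<dots> = \<zeta> x * (norm (g x))\<^sup>2 - 4 * (\<eta> x * W x * (g x \<bullet> grad \<eta> x)) + 4 * S x"
      unfolding S_def \<zeta>_def power2_norm_eq_inner
      by (simp add: inner_diff_left inner_diff_right inner_commute algebra_simps)
    finally show ?thesis
      unfolding h_def grad_\<zeta> P_def \<theta>
      by (simp add: inner_add_right power2_norm_eq_inner algebra_simps)
  qed
  \<comment> \<open>One inequality for both quantities: \<open>c_f\<close> bounds the right side of
    the equation from below, and \<open>absorb\<close> multiplied by \<open>a\<close> bounds the
    left side from above, with \<open>lam\<close> used on P and \<open>Lam\<close> on S.\<close>
  have energy: "c_f * (LINT x|lebesgue_on D. \<zeta> x * W x) + lam / 2 * (LINT x|lebesgue_on D. P x) \<le> 2 * Lam * E"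
  proof -
    have "c_f * (LINT x|lebesgue_on D. \<zeta> x * W x) = (LINT x|lebesgue_on D. c_f * (\<zeta> x * W x))"
      by simp
    also have "\<dots> \<le> (LINT x|lebesgue_on D. f x * (\<zeta> x * W x))"
      by (intro integral_mono_AE int_fv integrable_mult_right int_v, rule eventually_mono[OF f_bound])
        (use W0 \<zeta>01 in \<open>auto intro!: mult_right_mono mult_nonneg_nonneg\<close>)
    also have "\<dots> = (LINT x|lebesgue_on D. a x * (g x \<bullet> h x))" by (rule eq[symmetric])
    also have "\<dots> \<le> (LINT x|lebesgue_on D. - (lam / 2) * P x + (2 * Lam) * S x)"
    proof (intro integral_mono_AE int_agh Bochner_Integration.integrable_add integrable_mult_right int_P int_S,
        rule eventually_mono[OF a_bounds])
      fix x assume a: "lam \<le> a x \<and> a x \<le> Lam"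
      have P0: "0 \<le> P x" and S0: "0 \<le> S x" using \<zeta>01[of x] \<theta>01[of x] by (simp_all add: P_def S_def)
      have "a x * (g x \<bullet> h x) \<le> a x * (- (P x) / 2 + 2 * S x)"
        using a lam_pos by (intro mult_left_mono absorb) auto
      also have "\<dots> \<le> - (lam / 2) * P x + (2 * Lam) * S x"
        using mult_right_mono[of lam "a x" "P x"] mult_right_mono[of "a x" Lam "S x"] a P0 S0
        by (simp add: algebra_simps)
      finally show "a x * (g x \<bullet> h x) \<le> - (lam / 2) * P x + (2 * Lam) * S x" .
    qed
    also have "\<dots> = - (lam / 2) * (LINT x|lebesgue_on D. P x) + 2 * Lam * E"
      using int_P int_S by (simp add: E)
    finally show ?thesis by simp
  qed
  have v0: "0 \<le> (LINT x|lebesgue_on D. \<zeta> x * W x)"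
    using \<zeta>01 W0 by (intro integral_nonneg_AE) auto
  have P0: "0 \<le> (LINT x|lebesgue_on D. P x)"
    using \<zeta>01 \<theta>01 by (intro integral_nonneg_AE) (auto simp: P_def)
  have v_le: "(LINT x|lebesgue_on D. \<bar>\<zeta> x * W x\<bar>) \<le> 2 * Lam / c_f * E"
  proof -
    have "0 \<le> lam / 2 * (LINT x|lebesgue_on D. P x)" using lam_pos P0 by simp
    then have "c_f * (LINT x|lebesgue_on D. \<zeta> x * W x) \<le> 2 * Lam * E" using energy by linarith
    moreover have "\<bar>\<zeta> x * W x\<bar> = \<zeta> x * W x" for x using \<zeta>01[of x] W0[of x] by simp
    ultimately show ?thesis using c_f_pos by (simp add: pos_le_divide_eq mult.commute)
  qed
  have P_le: "(LINT x|lebesgue_on D. P x) \<le> 4 * Lam / lam * E"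
  proof -
    have "0 \<le> c_f * (LINT x|lebesgue_on D. \<zeta> x * W x)" using c_f_pos v0 by simp
    then have "lam / 2 * (LINT x|lebesgue_on D. P x) \<le> 2 * Lam * E" using energy by linarith
    then show ?thesis using lam_pos by (simp add: pos_le_divide_eq mult.commute)
  qed
  have h_le: "(LINT x|lebesgue_on D. (norm (h x))\<^sup>2) \<le> (8 + 8 * Lam / lam) * E"
  proof -
    \<comment> \<open>A factor 2 comes from splitting \<open>h\<close>, and 4 from |grad \<zeta>|^2
      = 4 \<zeta> |grad \<eta>|^2; remaining factors \<zeta> and \<theta> are at most 1.\<close>
    have "(norm (h x))\<^sup>2 \<le> 8 * S x + 2 * P x" for x
    proof -
      have "(norm (h x))\<^sup>2 \<le> 2 * (norm (W x *\<^sub>R grad \<zeta> x))\<^sup>2 + 2 * (norm ((\<zeta> x * - \<theta> x) *\<^sub>R g x))\<^sup>2"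
        unfolding h_def by (rule norm_add_sq_le)
      also have "(norm (W x *\<^sub>R grad \<zeta> x))\<^sup>2 = 4 * \<zeta> x * S x"
        unfolding grad_\<zeta> S_def by (simp add: \<zeta>_def power_mult_distrib power2_eq_square)
      also have "4 * \<zeta> x * S x \<le> 4 * S x"
        using mult_right_mono[OF \<zeta>01(2)[of x], of "4 * S x"] by (simp add: S_def)
      also have "(norm ((\<zeta> x * - \<theta> x) *\<^sub>R g x))\<^sup>2 = (\<zeta> x * \<theta> x) * P x"
        by (simp add: P_def power_mult_distrib power2_eq_square)
      also have "\<dots> \<le> P x"
        using \<zeta>01[of x] \<theta>01[of x] by (intro mult_left_le_one_le mult_le_one) (auto simp: P_def)
      finally show ?thesis by simp
    qed
    then have "(LINT x|lebesgue_on D. (norm (h x))\<^sup>2) \<le> (LINT x|lebesgue_on D. 8 * S x + 2 * P x)"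
      using int_S int_P L2D(2)[OF h_L2] by (intro integral_mono) auto
    also have "\<dots> = 8 * E + 2 * (LINT x|lebesgue_on D. P x)"
      using int_S int_P by (simp add: E)
    also have "\<dots> \<le> (8 + 8 * Lam / lam) * E" using P_le by (simp add: distrib_right)
    finally show ?thesis .
  qed
  have "(LINT x|lebesgue_on D. \<bar>\<zeta> x * W x\<bar>)\<^sup>2 \<le> (2 * Lam / c_f * E)\<^sup>2"
    by (intro power_mono v_le integral_nonneg_AE) auto
  then have "(LINT x|lebesgue_on D. (\<zeta> x * W x)\<^sup>2) \<le>
      \<rho>\<^sup>2 / 2 * ((8 + 8 * Lam / lam) * E) + (2 * Lam / c_f * E)\<^sup>2 / measure lborel (ball (0::'a) \<rho>)"
    by (intro order_trans[OF Nash] add_mono mult_left_mono divide_right_mono h_le) auto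
  then show ?thesis by (simp add: \<zeta>_def W_def power2_eq_square)
qed

end

section \<open>Iteration\<close>

text \<open>A ball is connected, so if it left \<open>D\<close> it would meet the frontier, at a
  distance from its centre below its radius.\<close>

lemma ball_infdist_frontier_subset:
  fixes D :: "'a::real_normed_vector set"
  assumes "x \<in> D"
  shows "ball x (infdist x (frontier D)) \<subseteq> D"
proof (rule ccontr)
  assume "\<not> ?thesis"
  then obtain y where "y \<in> ball x (infdist x (frontier D))" "y \<notin> D" by blast
  moreover from this have "x \<in> ball x (infdist x (frontier D))" by (auto intro: le_less_trans[OF zero_le_dist])
  ultimately have "ball x (infdist x (frontier D)) \<inter> frontier D \<noteq> {}"
    using assms by (intro connected_Int_frontier connected_ball) blast+
  then show False
    using infdist_le[of _ "frontier D" x] by fastforce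
qed

section \<open>Decay of the local energies and the pointwise bound\<close>

context weak_problem
begin

definition local_energy :: "real \<Rightarrow> 'a \<Rightarrow> real \<Rightarrow> real" where
  "local_energy k z r = (LINT x|lebesgue_on D. indicator (ball z r) x * (max (k - u x) 0)\<^sup>2)"

lemma local_energy_integrable:
  "integrable (lebesgue_on D) (\<lambda>x. indicator (ball z r) x * (max (k - u x) 0)\<^sup>2)"
proof -
  have "(\<lambda>x. indicator (ball z r) x *\<^sub>R max (k - u x) 0) \<in> L2 D"
  proof (rule L2_mult_bounded[OF truncation_L2, of _ 1])
    show "indicator (ball z r) \<in> borel_measurable (lebesgue_on D)"
      by (intro borel_measurable_lebesgue_on borel_measurable_indicator) simp
  qed (simp add: indicator_def)
  moreover have "(norm (indicator (ball z r) x *\<^sub>R max (k - u x) 0))\<^sup>2 = indicator (ball z r) x * (max (k - u x) 0)\<^sup>2" for x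
    by (cases "x \<in> ball z r") simp_all
  ultimately show ?thesis using L2D(2) by fastforce
qed

lemma local_energy_nonneg: "0 \<le> local_energy k z r"
  unfolding local_energy_def by (intro integral_nonneg_AE) auto

lemma local_energy_mono: "r \<le> r' \<Longrightarrow> local_energy k z r \<le> local_energy k z r'"
  unfolding local_energy_def
  by (intro integral_mono local_energy_integrable) (auto simp: indicator_def)

text \<open>\<open>E'\<close> majorizes the cutoff error, by the gradient bound for the cutoff and
  its vanishing outside the larger ball. The factor exp 4 compensates for the cutoff's fourth power,
  which is at least exp(-4) on the smaller ball.\<close>

lemma local_energy_step:
  assumes r: "0 < r'" "r' < r" "cball z r \<subseteq> D" and \<rho>: "0 < \<rho>"
    and E'_def: "E' = 4 / (r - r')\<^sup>2 * local_energy k z r"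
  shows "local_energy k z r' \<le>
    exp 4 * (\<rho>\<^sup>2 / 2 * ((8 + 8 * Lam / lam) * E') + (2 * Lam / c_f * E')\<^sup>2 / measure lborel (ball (0::'a) \<rho>))"
proof -
  obtain \<eta> where \<eta>: "\<eta> \<in> test_functions D" "\<And>x. 0 \<le> \<eta> x" "\<And>x. \<eta> x \<le> 1"
    and \<eta>_inner: "\<And>x. x \<in> ball z r' \<Longrightarrow> exp (-1) \<le> \<eta> x"
    and grad_\<eta>: "\<And>x. norm (grad \<eta> x) \<le> 2 / (r - r')" "\<And>x. x \<notin> ball z r \<Longrightarrow> grad \<eta> x = 0"
    using bump_cutoff[OF r] by blast
  define W where "W = (\<lambda>x. max (k - u x) 0)"
  have W0: "0 \<le> W x" for x by (simp add: W_def)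
  define E where "E = (LINT x|lebesgue_on D. (norm (W x *\<^sub>R grad \<eta> x))\<^sup>2)"
  have "E \<le> (LINT x|lebesgue_on D. 4 / (r - r')\<^sup>2 * (indicator (ball z r) x * (W x)\<^sup>2))"
    unfolding E_def
  proof (intro integral_mono_AE' AE_I2)
    show "integrable (lebesgue_on D) (\<lambda>x. 4 / (r - r')\<^sup>2 * (indicator (ball z r) x * (W x)\<^sup>2))"
      unfolding W_def by (intro integrable_mult_right local_energy_integrable)
    show "(norm (W x *\<^sub>R grad \<eta> x))\<^sup>2 \<le> 4 / (r - r')\<^sup>2 * (indicator (ball z r) x * (W x)\<^sup>2)" for x
    proof (cases "x \<in> ball z r")
      case True
      have "(norm (grad \<eta> x))\<^sup>2 \<le> (2 / (r - r'))\<^sup>2"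
        by (intro power_mono grad_\<eta>) simp
      then have "(W x)\<^sup>2 * (norm (grad \<eta> x))\<^sup>2 \<le> (W x)\<^sup>2 * (2 / (r - r'))\<^sup>2"
        by (rule mult_left_mono) simp
      then show ?thesis using True by (simp add: power_mult_distrib power_divide mult.commute)
    qed (simp add: grad_\<eta>(2))
  qed simp
  then have E_le: "E \<le> E'" by (simp add: E'_def local_energy_def W_def)
  have E0: "0 \<le> E" unfolding E_def by (intro integral_nonneg_AE) auto
  have "exp (-4) * local_energy k z r' = (LINT x|lebesgue_on D. exp (-4) * (indicator (ball z r') x * (W x)\<^sup>2))"
    by (simp add: local_energy_def W_def)
  also have "\<dots> \<le> (LINT x|lebesgue_on D. ((\<eta> x)\<^sup>2 * W x)\<^sup>2)"
  proof (rule integral_mono)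
    show "integrable (lebesgue_on D) (\<lambda>x. exp (-4) * (indicator (ball z r') x * (W x)\<^sup>2))"
      unfolding W_def by (intro integrable_mult_right local_energy_integrable)
    have "(\<lambda>x. (\<eta> x)\<^sup>2 *\<^sub>R W x) \<in> L2 D"
      unfolding W_def
    proof (rule L2_mult_bounded[OF truncation_L2, of _ 1])
      show "(\<lambda>x. (\<eta> x)\<^sup>2) \<in> borel_measurable (lebesgue_on D)"
        using L2D(1)[OF test_function_L2(1)[OF \<eta>(1)]] by measurable
    qed (use \<eta>(2,3) in \<open>auto intro: power_le_one\<close>)
    from L2D(2)[OF this] show "integrable (lebesgue_on D) (\<lambda>x. ((\<eta> x)\<^sup>2 * W x)\<^sup>2)" by simp
    show "exp (-4) * (indicator (ball z r') x * (W x)\<^sup>2) \<le> ((\<eta> x)\<^sup>2 * W x)\<^sup>2" for x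
    proof (cases "x \<in> ball z r'")
      case True
      have "exp (-4) = exp (-1::real) ^ 4" by (simp flip: exp_of_nat_mult)
      also have "\<dots> \<le> (\<eta> x) ^ 4" by (intro power_mono \<eta>_inner True) simp
      finally have "exp (-4) * (W x)\<^sup>2 \<le> (\<eta> x) ^ 4 * (W x)\<^sup>2" by (rule mult_right_mono) simp
      then show ?thesis using True by (simp add: power_mult_distrib flip: power_mult)
    qed simp
  qed
  also have "\<dots> \<le> \<rho>\<^sup>2 / 2 * ((8 + 8 * Lam / lam) * E) + (2 * Lam / c_f * E)\<^sup>2 / measure lborel (ball (0::'a) \<rho>)"
    using truncation_energy[OF \<eta> \<rho> E_def[unfolded W_def]] by (simp add: W_def)
  also have "\<dots> \<le> \<rho>\<^sup>2 / 2 * ((8 + 8 * Lam / lam) * E') + (2 * Lam / c_f * E')\<^sup>2 / measure lborel (ball (0::'a) \<rho>)"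
    using lam_pos Lam_pos c_f_pos E0
    by (intro add_mono mult_left_mono divide_right_mono power_mono E_le) auto
  finally have le: "exp (-4) * local_energy k z r' \<le>
      \<rho>\<^sup>2 / 2 * ((8 + 8 * Lam / lam) * E') + (2 * Lam / c_f * E')\<^sup>2 / measure lborel (ball (0::'a) \<rho>)" .
  have "local_energy k z r' = exp 4 * (exp (-4) * local_energy k z r')"
    by (simp add: exp_minus)
  also have "\<dots> \<le> exp 4 * (\<rho>\<^sup>2 / 2 * ((8 + 8 * Lam / lam) * E') + (2 * Lam / c_f * E')\<^sup>2 / measure lborel (ball (0::'a) \<rho>))"
    by (rule mult_left_mono[OF le]) simp
  finally show ?thesis .
qed

text \<open>The starting value of the iteration. Nonnegativity of \<open>u\<close> enters here: it
  caps the truncation at \<open>k\<close>.\<close>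

lemma local_energy_le:
  assumes k: "0 \<le> k" and r: "0 \<le> r" "cball z r \<subseteq> D"
  shows "local_energy k z r \<le> k\<^sup>2 * (r ^ DIM('a) * measure lborel (ball (0::'a) 1))"
proof -
  have D: "ball z r \<subseteq> D" using r(2) ball_subset_cball by blast
  have fin: "emeasure lborel (ball z r) < \<infinity>" by (rule emeasure_bounded_finite[OF bounded_ball])
  have eq: "(LINT x|lebesgue_on D. indicator (ball z r) x * k\<^sup>2) = (LINT x|lborel. indicator (ball z r) x * k\<^sup>2)"
    using D by (intro integral_lebesgue_on_eq_lborel sets_D) (auto simp: indicator_def)
  have "local_energy k z r \<le> (LINT x|lebesgue_on D. indicator (ball z r) x * k\<^sup>2)"
    unfolding local_energy_def
  proof (rule integral_mono_AE[OF local_energy_integrable])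
    show "integrable (lebesgue_on D) (\<lambda>x. indicator (ball z r) x * k\<^sup>2)"
      by (intro L2_integrable L2_bounded[of _ "k\<^sup>2"] borel_measurable_lebesgue_on) (auto simp: indicator_def)
    show "AE x in lebesgue_on D. indicator (ball z r) x * (max (k - u x) 0)\<^sup>2 \<le> indicator (ball z r) x * k\<^sup>2"
      using solution_nonneg
    proof (rule eventually_mono)
      fix x assume "0 \<le> u x"
      then have "(max (k - u x) 0)\<^sup>2 \<le> k\<^sup>2" using k by (intro power_mono) auto
      then show "indicator (ball z r) x * (max (k - u x) 0)\<^sup>2 \<le> indicator (ball z r) x * k\<^sup>2"
        by (intro mult_left_mono) auto
    qed
  qed
  also have "\<dots> = k\<^sup>2 * measure lborel (ball z r)"
    unfolding eq using fin by (simp add: mult.commute)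
  also have "\<dots> = k\<^sup>2 * (r ^ DIM('a) * measure lborel (ball (0::'a) 1))"
    by (simp only: content_ball_conv_unit_ball[OF r(1)])
  finally show ?thesis .
qed

text \<open>\<beta> is the growth of the quadratic term per step: halving the gap multiplies the
  squared cutoff error by 16, and halving \<rho> multiplies the reciprocal ball volume by 2^d. The
  two smallness conditions are free of R and z because the iteration is scale invariant.\<close>

lemma solution_lower_bound_ball:
  assumes R: "0 < R" "cball z R \<subseteq> D" and \<tau>: "0 < \<tau>" and \<kappa>: "0 < \<kappa>"
    and \<beta>: "\<beta> = 16 * 2 ^ DIM('a)"
    and \<tau>_small: "exp 4 * (8 + 8 * Lam / lam) * 64 * \<tau>\<^sup>2 \<le> 1 / \<beta>"
    and \<kappa>_small: "exp 4 * (2 * Lam / c_f)\<^sup>2 * 4096 / \<tau> ^ DIM('a) * \<kappa>\<^sup>2 \<le> 1 / (2 * \<beta>)"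
  shows "AE x in lebesgue_on D. x \<in> ball z (R / 2) \<longrightarrow> \<kappa> * R\<^sup>2 \<le> u x"
proof -
  define k where "k = \<kappa> * R\<^sup>2"
  define d where "d = DIM('a)"
  define \<omega> where "\<omega> = measure lborel (ball (0::'a) 1)"
  have \<omega>: "0 < \<omega>" unfolding \<omega>_def by (rule content_ball_pos) simp
  \<comment> \<open>The radii decrease from R towards R/2, with gap R / (4 * 2^j) at step j.\<close>
  define r where "r = (\<lambda>j::nat. R * (1 / 2 + (1 / 2) ^ Suc j))"
  define X where "X = (\<lambda>j. local_energy k z (r j))"
  \<comment> \<open>4096 = 64^2, where 64 = 4 * 4^2 comes from 4 divided by the squared gap.\<close>
  define K where "K = exp 4 * (2 * Lam / c_f)\<^sup>2 * 4096 / \<tau> ^ d"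
  define C where "C = K / (R ^ 4 * R ^ d * \<omega>)"
  define V where "V = k\<^sup>2 * (R ^ d * \<omega>)"
  have X0: "0 \<le> X j" for j unfolding X_def by (rule local_energy_nonneg)
  have \<beta>1: "1 < \<beta>"
  proof -
    have "1 \<le> (2::real) ^ DIM('a)" by simp
    then show ?thesis unfolding \<beta> by linarith
  qed
  have decay: "X j \<le> V / \<beta> ^ j" for j
  proof (rule superlinear_decay[where C = C])
    show "0 \<le> C" "0 \<le> V" using R(1) \<omega> \<tau> by (simp_all add: C_def V_def K_def)
    \<comment> \<open>V contains k^2 = \<kappa>^2 R^4, which cancels the powers of R in C together
      with R^d \<omega>.\<close>
    have "C * V = K * \<kappa>\<^sup>2"
      using R(1) \<omega> by (simp add: C_def V_def k_def power_mult_distrib field_simps flip: power_mult)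
    then show "C * V \<le> 1 / (2 * \<beta>)" using \<kappa>_small by (simp add: K_def d_def)
    show "X 0 \<le> V"
      using local_energy_le[of k R z] R \<kappa> by (simp add: X_def r_def V_def d_def \<omega>_def k_def)
    fix j :: nat
    define y where "y = (2::real) ^ j"
    have y: "0 < y" by (simp add: y_def)
    \<comment> \<open>Proportional to the gap, so that \<rho>^2 cancels the y^2 / R^2 from the
      cutoff gradient. The linear term then has a coefficient independent of j and R, which \<tau>
      makes at most 1 / (2 \<beta>).\<close>
    define \<rho> where "\<rho> = R * \<tau> / y"
    have \<rho>: "0 < \<rho>" using R(1) \<tau> y by (simp add: \<rho>_def)
    have rj: "r j - r (Suc j) = R / (4 * y)" by (simp add: r_def y_def field_simps power_divide)
    have "0 < r (Suc j)" using R(1) by (simp add: r_def add_pos_pos)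
    moreover have "r (Suc j) < r j" using rj divide_pos_pos[of R "4 * y"] R(1) y by linarith
    moreover have "r j \<le> R"
    proof -
      have "(1 / 2 :: real) ^ Suc j \<le> 1 / 2" using power_le_one[of "1 / 2 :: real" j] by simp
      then show ?thesis using R(1) by (simp add: r_def)
    qed
    then have "cball z (r j) \<subseteq> D" using R(2) by (meson order_trans subset_cball)
    ultimately have "X (Suc j) \<le> exp 4 * (\<rho>\<^sup>2 / 2 * ((8 + 8 * Lam / lam) * (4 / (r j - r (Suc j))\<^sup>2 * X j)) +
        (2 * Lam / c_f * (4 / (r j - r (Suc j))\<^sup>2 * X j))\<^sup>2 / measure lborel (ball (0::'a) \<rho>))"
      unfolding X_def by (rule local_energy_step[OF _ _ _ \<rho> refl])
    also have "4 / (r j - r (Suc j))\<^sup>2 * X j = 64 * y\<^sup>2 / R\<^sup>2 * X j"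
      unfolding rj using R(1) y by (simp add: power_divide power_mult_distrib)
    also have "measure lborel (ball (0::'a) \<rho>) = R ^ d * \<tau> ^ d / y ^ d * \<omega>"
      using \<rho> by (subst content_ball_conv_unit_ball)
        (simp_all add: \<rho>_def \<omega>_def d_def power_divide power_mult_distrib)
    also have "exp 4 * (\<rho>\<^sup>2 / 2 * ((8 + 8 * Lam / lam) * (64 * y\<^sup>2 / R\<^sup>2 * X j)) +
        (2 * Lam / c_f * (64 * y\<^sup>2 / R\<^sup>2 * X j))\<^sup>2 / (R ^ d * \<tau> ^ d / y ^ d * \<omega>)) =
      (exp 4 * (8 + 8 * Lam / lam) * 64 * \<tau>\<^sup>2) * (X j / 2) + C * (y ^ 4 * y ^ d) * (X j)\<^sup>2"
    proof -
      have "exp 4 * (\<rho>\<^sup>2 / 2 * ((8 + 8 * Lam / lam) * (64 * y\<^sup>2 / R\<^sup>2 * X j))) =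
          (exp 4 * (8 + 8 * Lam / lam) * 64 * \<tau>\<^sup>2) * (X j / 2) * ((R\<^sup>2 / R\<^sup>2) * (y\<^sup>2 / y\<^sup>2))"
        unfolding \<rho>_def power_divide power_mult_distrib by (simp add: mult_ac)
      then have 1: "exp 4 * (\<rho>\<^sup>2 / 2 * ((8 + 8 * Lam / lam) * (64 * y\<^sup>2 / R\<^sup>2 * X j))) =
          (exp 4 * (8 + 8 * Lam / lam) * 64 * \<tau>\<^sup>2) * (X j / 2)" using R(1) y by simp
      have 2: "exp 4 * ((2 * Lam / c_f * (64 * y\<^sup>2 / R\<^sup>2 * X j))\<^sup>2 / (R ^ d * \<tau> ^ d / y ^ d * \<omega>)) =
          C * (y ^ 4 * y ^ d) * (X j)\<^sup>2"
        unfolding C_def K_def power_divide power_mult_distrib by (simp add: mult_ac flip: power_mult)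
      show ?thesis unfolding distrib_left[of "exp 4"] 1 2 ..
    qed
    also have "y ^ 4 * y ^ d = \<beta> ^ j"
    proof -
      have "y ^ 4 = (2 ^ 4) ^ j" "y ^ d = (2 ^ d) ^ j"
        unfolding y_def by (simp_all only: power_mult[symmetric] mult.commute)
      then show ?thesis unfolding \<beta> d_def by (simp add: power_mult_distrib)
    qed
    finally have "X (Suc j) \<le> (exp 4 * (8 + 8 * Lam / lam) * 64 * \<tau>\<^sup>2) * (X j / 2) + C * \<beta> ^ j * (X j)\<^sup>2" .
    also have "\<dots> \<le> (1 / \<beta>) * (X j / 2) + C * \<beta> ^ j * (X j)\<^sup>2"
      using X0[of j] by (intro add_right_mono mult_right_mono \<tau>_small) simp
    finally show "X (Suc j) \<le> X j / (2 * \<beta>) + C * \<beta> ^ j * (X j)\<^sup>2" by (simp add: mult.commute)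
  qed (use \<beta>1 X0 in auto)
  \<comment> \<open>R/2 lies below every radius, so its energy is below all X j and must vanish in
    the limit.\<close>
  have le: "local_energy k z (R / 2) \<le> V * (1 / \<beta>) ^ j" for j
  proof -
    have "local_energy k z (R / 2) \<le> X j"
      unfolding X_def using R(1) by (intro local_energy_mono) (simp add: r_def)
    also note decay[of j]
    finally show ?thesis by (simp add: power_divide)
  qed
  have "(\<lambda>j. V * (1 / \<beta>) ^ j) \<longlonglongrightarrow> 0"
    using \<beta>1 by (intro tendsto_mult_right_zero LIMSEQ_power_zero) simp
  then have "local_energy k z (R / 2) \<le> 0"
    using le by (intro LIMSEQ_le_const) auto
  then have "local_energy k z (R / 2) = 0"
    using local_energy_nonneg by (intro antisym)
  then have "AE x in lebesgue_on D. indicator (ball z (R / 2)) x * (max (k - u x) 0)\<^sup>2 = 0"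
    unfolding local_energy_def
    by (subst (asm) integral_nonneg_eq_0_iff_AE[OF local_energy_integrable]) auto
  then show ?thesis
    by (rule eventually_mono) (auto simp: k_def max_def split: if_splits)
qed

text \<open>Each ball comes with its own null set, so only countably many may be used: centres in a
  countable dense set and rational radii.\<close>

lemma solution_lower_bound:
  assumes \<kappa>: "0 < \<kappa>" and ball: "\<And>z R. 0 < R \<Longrightarrow> cball z R \<subseteq> D \<Longrightarrow>
      AE x in lebesgue_on D. x \<in> ball z (R / 2) \<longrightarrow> \<kappa> * R\<^sup>2 \<le> u x"
  shows "AE x in lebesgue_on D. \<kappa> / 4 * (infdist x (frontier D))\<^sup>2 \<le> u x"
proof -
  obtain S :: "'a set" where S: "countable S" "\<And>U. open U \<Longrightarrow> U \<noteq> {} \<Longrightarrow> \<exists>q\<in>S. q \<in> U"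
    using countable_dense_setE by blast
  have "AE x in lebesgue_on D. \<forall>(q, R) \<in> S \<times> \<rat>. 0 < R \<and> cball q R \<subseteq> D \<and> x \<in> ball q (R / 2) \<longrightarrow> \<kappa> * R\<^sup>2 \<le> u x"
  proof (subst AE_ball_countable)
    show "countable (S \<times> (\<rat> :: real set))" by (intro countable_SIGMA S(1) countable_rat)
    show "\<forall>p\<in>S \<times> \<rat>. AE x in lebesgue_on D. case p of (q, R) \<Rightarrow>
        0 < R \<and> cball q R \<subseteq> D \<and> x \<in> ball q (R / 2) \<longrightarrow> \<kappa> * R\<^sup>2 \<le> u x"
    proof (clarify)
      fix q :: 'a and R :: real
      show "AE x in lebesgue_on D. 0 < R \<and> cball q R \<subseteq> D \<and> x \<in> ball q (R / 2) \<longrightarrow> \<kappa> * R\<^sup>2 \<le> u x"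
        using ball[of R q] by (cases "0 < R \<and> cball q R \<subseteq> D") auto
    qed
  qed
  then show ?thesis using solution_nonneg AE_space
  proof eventually_elim
    case (elim x)
    define \<delta> where "\<delta> = infdist x (frontier D)"
    have x: "x \<in> D" using elim(3) sets_D by simp
    have "0 \<le> \<delta>" unfolding \<delta>_def by (rule infdist_nonneg)
    show ?case
    proof (cases "\<delta> = 0")
      case True
      then show ?thesis using elim(2) by (simp add: \<delta>_def)
    next
      case False
      then have \<delta>: "0 < \<delta>" using \<open>0 \<le> \<delta>\<close> by simp
      \<comment> \<open>With |q - x| < \<delta>/4, the upper bound on R keeps the closed ball around
        q inside the ball of radius \<delta> around x, and the lower bound puts x within R/2 of q.
        Moreover R > \<delta>/2 produces the factor 1/4.\<close>
      obtain R where R: "R \<in> \<rat>" "\<delta> / 2 < R" "R < 3 * \<delta> / 4"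
        using Rats_dense_in_real[of "\<delta> / 2" "3 * \<delta> / 4"] \<delta> by auto
      obtain q where q: "q \<in> S" "q \<in> ball x (\<delta> / 4)"
        using S(2)[of "ball x (\<delta> / 4)"] \<delta> by auto
      have "cball q R \<subseteq> ball x \<delta>"
      proof
        fix y assume "y \<in> cball q R"
        then show "y \<in> ball x \<delta>" using dist_triangle[of x y q] q(2) R(3) by simp
      qed
      then have "cball q R \<subseteq> D"
        using ball_infdist_frontier_subset[OF x] by (auto simp: \<delta>_def)
      moreover have "x \<in> ball q (R / 2)" using q(2) R(2) by (simp add: dist_commute)
      ultimately have u: "\<kappa> * R\<^sup>2 \<le> u x" using elim(1) q(1) R(1,2) \<delta> by force
      have "(\<delta> / 2)\<^sup>2 \<le> R\<^sup>2" using R(2) \<delta> by (intro power_mono) auto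
      then have "\<kappa> * (\<delta> / 2)\<^sup>2 \<le> \<kappa> * R\<^sup>2" using \<kappa> by (intro mult_left_mono) auto
      then show ?thesis using u by (simp add: \<delta>_def power_divide)
    qed
  qed
qed

end

text \<open>The null sequence in \<open>H10\<close> is a sum of two nonnegative terms, so both tend
  to 0. Test functions with their classical gradients are legitimate choices in the weak
  formulation, which gives the equation of the locale.\<close>

lemma weak_solution_weak_problem:
  assumes "bounded_open_set D" "0 < lam" "0 < Lam" "0 < c_f"
    and a: "a \<in> admissible_coeffs D lam Lam" and f: "f \<in> L2 D" "AE x in lebesgue_on D. c_f \<le> f x"
    and u: "weak_solution D a f u"
  obtains g \<phi> where "weak_problem D a f u g \<phi> lam Lam c_f"
proof -
  interpret bounded_open_set D by fact
  from u have "u \<in> H10 D" by (simp add: weak_solution_def)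
  then obtain g \<phi> where uL2: "u \<in> L2 D" and g: "g \<in> L2 D" "weak_gradient D u g"
    and \<phi>: "\<And>n::nat. \<phi> n \<in> test_functions D"
    and lim: "(\<lambda>n. (LINT x|lebesgue_on D. (u x - \<phi> n x)\<^sup>2) +
             (LINT x|lebesgue_on D. (norm (g x - grad (\<phi> n) x))\<^sup>2)) \<longlonglongrightarrow> 0"
    by (auto simp: H10_def)
  have "(\<lambda>n. LINT x|lebesgue_on D. (u x - \<phi> n x)\<^sup>2) \<longlonglongrightarrow> 0"
    by (rule Lim_null_comparison[OF always_eventually lim]) (auto intro!: integral_nonneg_AE)
  moreover have "(\<lambda>n. LINT x|lebesgue_on D. (norm (g x - grad (\<phi> n) x))\<^sup>2) \<longlonglongrightarrow> 0"
    by (rule Lim_null_comparison[OF always_eventually lim]) (auto intro!: integral_nonneg_AE)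
  ultimately have "L2_tendsto D \<phi> u" "L2_tendsto D (\<lambda>n. grad (\<phi> n)) g"
    by (simp_all add: L2_tendsto_def norm_minus_commute power2_commute)
  moreover have "(LINT x|lebesgue_on D. a x * (g x \<bullet> grad v x)) = (LINT x|lebesgue_on D. f x * v x)"
    if "v \<in> test_functions D" for v
    using u g(2) test_function_H10[OF that] test_function_weak_gradient[OF that]
    unfolding weak_solution_def by blast
  ultimately have "weak_problem D a f u g \<phi> lam Lam c_f"
    using assms(2-4) a f uL2 g(1) \<phi>
    by unfold_locales (auto simp: admissible_coeffs_def)
  then show ?thesis by (rule that)
qed

theorem lemma3p7:
  fixes D :: "'a::euclidean_space set" and lam Lam c_f :: real
  assumes "DIM('a) \<ge> 2"
    and "lipschitz_domain D"
    and "0 < lam" and "0 < Lam"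
    and "0 < c_f"
  shows "\<exists>c>0. \<forall>a f.
           a \<in> admissible_coeffs D lam Lam \<and> f \<in> L2 D \<and> (AE x in lebesgue_on D. c_f \<le> f x) \<longrightarrow>
           positivity_condition D a f 2 c"
proof -
  have D: "bounded_open_set D"
    using assms(2) by (simp add: lipschitz_domain_def bounded_open_set_def)
  \<comment> \<open>\<tau> and \<kappa> turn the smallness conditions of
    \<open>solution_lower_bound_ball\<close> into equalities; \<tau> is fixed first since K contains
    it. Only the dimension, \<open>lam\<close>, \<open>Lam\<close> and \<open>c_f\<close>
    enter.\<close>
  define \<beta> :: real where "\<beta> = 16 * 2 ^ DIM('a)"
  define A where "A = exp 4 * (8 + 8 * Lam / lam) * 64"
  define \<tau> where "\<tau> = sqrt (1 / (A * \<beta>))"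
  define K where "K = exp 4 * (2 * Lam / c_f)\<^sup>2 * 4096 / \<tau> ^ DIM('a)"
  define \<kappa> where "\<kappa> = sqrt (1 / (K * (2 * \<beta>)))"
  have \<beta>: "0 < \<beta>" by (simp add: \<beta>_def)
  have A: "0 < A" unfolding A_def using assms by (simp add: add_pos_pos)
  have \<tau>: "0 < \<tau>" "A * \<tau>\<^sup>2 = 1 / \<beta>" using A \<beta> by (simp_all add: \<tau>_def)
  have K: "0 < K" unfolding K_def using \<tau>(1) assms by simp
  have \<kappa>: "0 < \<kappa>" "K * \<kappa>\<^sup>2 = 1 / (2 * \<beta>)" using K \<beta> by (simp_all add: \<kappa>_def)
  show ?thesis
  proof (intro exI[of _ "c_f * (\<kappa> / 4)"] conjI allI impI)
    show "0 < c_f * (\<kappa> / 4)" using \<kappa>(1) assms by simp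
    fix a f
    assume af: "a \<in> admissible_coeffs D lam Lam \<and> f \<in> L2 D \<and> (AE x in lebesgue_on D. c_f \<le> f x)"
    show "positivity_condition D a f 2 (c_f * (\<kappa> / 4))"
      unfolding positivity_condition_def
    proof (intro allI impI)
      fix u g assume "weak_solution D a f u \<and> weak_gradient D u g"
      \<comment> \<open>\<open>g'\<close> need not be the given representative \<open>g\<close>. The
        lower bound obtained from it concerns \<open>u\<close> alone, and \<open>g\<close> enters
        the conclusion only through a nonnegative term.\<close>
      then obtain g' \<phi> where "weak_problem D a f u g' \<phi> lam Lam c_f"
        using weak_solution_weak_problem[OF D assms(3-5)] af by blast
      then interpret weak_problem D a f u g' \<phi> lam Lam c_f .
      have "AE x in lebesgue_on D. \<kappa> / 4 * (infdist x (frontier D))\<^sup>2 \<le> u x"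
        by (rule solution_lower_bound[OF \<kappa>(1) solution_lower_bound_ball[OF _ _ \<tau>(1) \<kappa>(1) \<beta>_def]])
          (use \<tau>(2) \<kappa>(2) in \<open>simp_all add: A_def K_def\<close>)
      then show "AE x in lebesgue_on D. c_f * (\<kappa> / 4) * infdist x (frontier D) powr 2 \<le> a x * (norm (g x))\<^sup>2 + f x * u x"
        using a_bounds f_bound
      proof eventually_elim
        case (elim x)
        have "infdist x (frontier D) powr 2 = (infdist x (frontier D))\<^sup>2"
          using infdist_nonneg[of x "frontier D"] by (simp add: powr_numeral)
        moreover have "c_f * (\<kappa> / 4 * (infdist x (frontier D))\<^sup>2) \<le> f x * u x"
          using elim c_f_pos \<kappa>(1) by (intro mult_mono) auto
        moreover have "0 \<le> a x * (norm (g x))\<^sup>2" using elim lam_pos by simp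
        ultimately show ?case by (simp add: mult.assoc)
      qed
    qed
  qed
qed

end
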